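(* Let $d\ge 1$ and let $a<b$ be real numbers. Let $f_0,f_1:\mathbb{R}^d\to\mathbb{C}$ be entire functions, and let $h$ be a solution of the Dirichlet problem for the slab $S_{a,b}=(a,b)\times\mathbb{R}^d$ with data $f_0,f_1$; that is, $h:[a,b]\times\mathbb{R}^d\to\mathbb{C}$ is continuous, $h$ is harmonic on $(a,b)\times\mathbb{R}^d$, and $h(a,y)=f_0(y)$ and $h(b,y)=f_1(y)$ for all $y\in\mathbb{R}^d$. Then $h$ extends to a harmonic function on all of $\mathbb{R}^{d+1}$, i.e. there is a harmonic function $\widetilde h:\mathbb{R}^{d+1}\to\mathbb{C}$ with $\widetilde h=h$ on $(a,b)\times\mathbb{R}^d$.
   Context: Points of $\mathbb{R}^{d+1}=\mathbb{R}\times\mathbb{R}^d$ are written $(t,y)$ with $t\in\mathbb{R}$, $y\in\mathbb{R}^d$. A function $f:\mathbb{R}^d\to\mathbb{C}$ is called entire if there is an analytic (holomorphic) function $F:\mathbb{C}^d\to\mathbb{C}$ with $F(x)=f(x)$ for all $x\in\mathbb{R}^d$. A complex-valued function on an open subset of Euclidean space is harmonic if it is twice continuously differentiable and its Laplacian (the sum of all pure second partial derivatives in all variables) vanishes identically there. *)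

theory Defs
  imports "HOL-Analysis.Analysis"
begin

text \<open>
  Holomorphic functions of several complex variables: Frechet differentiable at every point,
  with a complex-linear derivative. (\<^const>\<open>has_derivative\<close> alone only gives real-linearity;
  \<^const>\<open>vector_scalar_mult\<close>, written \<open>*s\<close>, is multiplication of a vector by a complex scalar.)
\<close>

definition holomorphic_everywhere :: "(complex ^ 'n::finite \<Rightarrow> complex) \<Rightarrow> bool" where
  "holomorphic_everywhere F \<longleftrightarrow>
     (\<forall>z. \<exists>D. (F has_derivative D) (at z) \<and> (\<forall>c v. D (c *s v) = c * D v))"

definition complex_vec :: "real ^ 'n::finite \<Rightarrow> complex ^ 'n" where
  "complex_vec x = (\<chi> i. complex_of_real (x $ i))"

definition entire :: "(real ^ 'n::finite \<Rightarrow> complex) \<Rightarrow> bool" where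
  "entire f \<longleftrightarrow> (\<exists>F. holomorphic_everywhere F \<and> (\<forall>x. F (complex_vec x) = f x))"

definition partial_deriv :: "('a::euclidean_space \<Rightarrow> complex) \<Rightarrow> 'a \<Rightarrow> 'a \<Rightarrow> complex" where
  "partial_deriv f i x = frechet_derivative f (at x) i"

text \<open>
  Twice continuous differentiability on an open set. The first-order partial derivatives are
  required to be differentiable, hence they are continuous and \<open>f\<close> is \<open>C\<^sup>1\<close>; continuity of the
  second-order ones makes \<open>f\<close> of class \<open>C\<^sup>2\<close>. The differentiability clauses also ensure that
  \<^const>\<open>frechet_derivative\<close> (a choice operator) denotes the actual derivative on the set.
\<close>

definition C2_on :: "'a::euclidean_space set \<Rightarrow> ('a \<Rightarrow> complex) \<Rightarrow> bool" where
  "C2_on S f \<longleftrightarrow>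
     (\<forall>x\<in>S. f differentiable (at x)) \<and>
     (\<forall>i\<in>Basis. \<forall>x\<in>S. partial_deriv f i differentiable (at x)) \<and>
     (\<forall>i\<in>Basis. \<forall>j\<in>Basis. continuous_on S (partial_deriv (partial_deriv f i) j))"

definition laplacian :: "('a::euclidean_space \<Rightarrow> complex) \<Rightarrow> 'a \<Rightarrow> complex" where
  "laplacian f x = (\<Sum>i\<in>Basis. partial_deriv (partial_deriv f i) i x)"

definition harmonic_on :: "'a::euclidean_space set \<Rightarrow> ('a \<Rightarrow> complex) \<Rightarrow> bool" where
  "harmonic_on S f \<longleftrightarrow> open S \<and> C2_on S f \<and> (\<forall>x\<in>S. laplacian f x = 0)"

definition slab :: "real \<Rightarrow> real \<Rightarrow> (real \<times> (real ^ 'n::finite)) set" where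
  "slab a b = {a<..<b} \<times> UNIV"

text \<open>
  Only the values of \<open>h\<close> on the closed slab matter: harmonicity on the open slab depends only
  on the values there, so \<open>h\<close> may be a total function.
\<close>

definition slab_dirichlet_solution ::
  "real \<Rightarrow> real \<Rightarrow> (real ^ 'n::finite \<Rightarrow> complex) \<Rightarrow> (real ^ 'n \<Rightarrow> complex)
    \<Rightarrow> (real \<times> (real ^ 'n) \<Rightarrow> complex) \<Rightarrow> bool" where
  "slab_dirichlet_solution a b f0 f1 h \<longleftrightarrow>
     continuous_on ({a..b} \<times> UNIV) h \<and>
     harmonic_on (slab a b) h \<and>
     (\<forall>y. h (a, y) = f0 y) \<and> (\<forall>y. h (b, y) = f1 y)"

end

theory Submission imports Defs "HOL-Complex_Analysis.Cauchy_Integral_Formula" begin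

text \<open>
  Why every slab solution with entire data extends. An entire \<open>f\<close> on the hyperplane \<open>t = a\<close> is the
  trace of a harmonic function \<open>u\<close> on the whole space, namely of the Cauchy--Kovalevskaya series
  \<open>\<Sum>k. (-1)\<^sup>k (t - a)\<^sup>2\<^sup>k / (2k)! \<Delta>\<^sup>k f(y)\<close>, which converges everywhere by Cauchy's estimates
  (\<open>entire_data_harmonic_extension\<close>). Then \<open>h - u\<close> vanishes on \<open>t = a\<close> and extends oddly across this
  hyperplane by Schwarz' reflection principle (\<open>reflection_principle\<close>), so \<open>h\<close> is continued to a slab
  of twice the width. On the new boundary hyperplane the continuation is expressed through the two
  global harmonic functions that carry the data at \<open>a\<close> and \<open>b\<close>, so it is again the trace of a
  global harmonic function, and the step can be repeated, alternately on both sides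
  (\<open>slab_solution_extend\<close>); the slabs exhaust the space.

  Reflection needs some regularity theory: a continuous function that is harmonic off the
  hyperplane and odd has to be shown to be twice continuously differentiable on it. The whole theory
  is based on the weak maximum principle and on polynomials, without surface integrals or Poisson
  kernels. The Dirichlet problem for the ball with polynomial boundary values is solved by a
  polynomial (\<open>polynomial_dirichlet_problem\<close>, pure algebra); continuous boundary values follow by the
  Stone--Weierstrass theorem and the maximum principle (\<open>dirichlet_problem_ball\<close>); and uniform limits of
  harmonic polynomials are smooth because Bernstein's method, again the maximum principle, bounds
  first derivatives in the interior (\<open>gradient_estimate\<close>). As a result harmonicity has a weak
  characterisation for continuous functions, \<open>weakly_harmonic_iff_approx\<close>, that is easy to check for
  reflected, glued and limit functions. The argument is carried out for real functions and applied to
  the real and imaginary parts.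
\<close>


section \<open>A weak Laplacian and the maximum principle\<close>

text \<open>
  Only second derivatives along coordinate lines are recorded: this is all the maximum principle
  needs, it is trivially stable under coordinate reflections and scalings, and it makes no
  statement about the regularity of \<open>v\<close> transversally to those lines.
\<close>

definition line_laplacian :: "('a::euclidean_space \<Rightarrow> real) \<Rightarrow> 'a \<Rightarrow> real \<Rightarrow> bool" where
  "line_laplacian v x L \<longleftrightarrow> (\<exists>v1 d.
     (\<forall>i\<in>Basis. (\<forall>\<^sub>F s in nhds 0. ((\<lambda>s. v (x + s *\<^sub>R i)) has_real_derivative v1 i s) (at s)) \<and>
                 (v1 i has_real_derivative d i) (at 0)) \<and>
     L = (\<Sum>i\<in>Basis. d i))"

text \<open>
  On open sets this is equivalent to classical harmonicity, see \<open>weakly_harmonic_iff_approx\<close>.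
\<close>

definition weakly_harmonic_on :: "'a::euclidean_space set \<Rightarrow> ('a \<Rightarrow> real) \<Rightarrow> bool" where
  "weakly_harmonic_on S v \<longleftrightarrow> continuous_on S v \<and> (\<forall>x\<in>S. line_laplacian v x 0)"

lemma line_laplacian_add:
  assumes "line_laplacian u x L" "line_laplacian v x M"
  shows "line_laplacian (\<lambda>x. u x + v x) x (L + M)"
proof -
  from assms(1) obtain u1 d where u:
    "\<And>i. i\<in>Basis \<Longrightarrow> \<forall>\<^sub>F s in nhds 0. ((\<lambda>s. u (x + s *\<^sub>R i)) has_real_derivative u1 i s) (at s)"
    "\<And>i. i\<in>Basis \<Longrightarrow> (u1 i has_real_derivative d i) (at 0)" "L = (\<Sum>i\<in>Basis. d i)"
    unfolding line_laplacian_def by blast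
  from assms(2) obtain v1 e where v:
    "\<And>i. i\<in>Basis \<Longrightarrow> \<forall>\<^sub>F s in nhds 0. ((\<lambda>s. v (x + s *\<^sub>R i)) has_real_derivative v1 i s) (at s)"
    "\<And>i. i\<in>Basis \<Longrightarrow> (v1 i has_real_derivative e i) (at 0)" "M = (\<Sum>i\<in>Basis. e i)"
    unfolding line_laplacian_def by blast
  show ?thesis unfolding line_laplacian_def
  proof (intro exI[of _ "\<lambda>i s. u1 i s + v1 i s"] exI[of _ "\<lambda>i. d i + e i"] conjI ballI)
    fix i :: 'a assume i: "i \<in> Basis"
    show "\<forall>\<^sub>F s in nhds 0. ((\<lambda>s. u (x + s *\<^sub>R i) + v (x + s *\<^sub>R i)) has_real_derivative
            u1 i s + v1 i s) (at s)"
      using u(1)[OF i] v(1)[OF i] by eventually_elim (rule DERIV_add)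
    show "((\<lambda>s. u1 i s + v1 i s) has_real_derivative d i + e i) (at 0)"
      using u(2)[OF i] v(2)[OF i] by (rule DERIV_add)
  qed (simp add: u v sum.distrib)
qed

lemma line_laplacian_cmult:
  assumes "line_laplacian u x L"
  shows "line_laplacian (\<lambda>x. c * u x) x (c * L)"
proof -
  from assms(1) obtain u1 d where u:
    "\<And>i. i\<in>Basis \<Longrightarrow> \<forall>\<^sub>F s in nhds 0. ((\<lambda>s. u (x + s *\<^sub>R i)) has_real_derivative u1 i s) (at s)"
    "\<And>i. i\<in>Basis \<Longrightarrow> (u1 i has_real_derivative d i) (at 0)" "L = (\<Sum>i\<in>Basis. d i)"
    unfolding line_laplacian_def by blast
  show ?thesis unfolding line_laplacian_def
  proof (intro exI[of _ "\<lambda>i s. c * u1 i s"] exI[of _ "\<lambda>i. c * d i"] conjI ballI)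
    fix i :: 'a assume i: "i \<in> Basis"
    show "\<forall>\<^sub>F s in nhds 0. ((\<lambda>s. c * u (x + s *\<^sub>R i)) has_real_derivative c * u1 i s) (at s)"
      using u(1)[OF i] by eventually_elim (rule DERIV_cmult)
    show "((\<lambda>s. c * u1 i s) has_real_derivative c * d i) (at 0)"
      using u(2)[OF i] by (rule DERIV_cmult)
  qed (simp add: u sum_distrib_left)
qed

lemma line_laplacian_diff:
  assumes "line_laplacian u x L" "line_laplacian v x M"
  shows "line_laplacian (\<lambda>x. u x - v x) x (L - M)"
  using line_laplacian_add[OF assms(1) line_laplacian_cmult[OF assms(2), of "-1"]] by simp

lemma line_laplacian_transform:
  assumes "line_laplacian u x L" "open S" "x \<in> S" "\<And>y. y \<in> S \<Longrightarrow> u y = v y"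
  shows "line_laplacian v x L"
proof -
  from assms(1) obtain u1 d where u:
    "\<And>i. i\<in>Basis \<Longrightarrow> \<forall>\<^sub>F s in nhds 0. ((\<lambda>s. u (x + s *\<^sub>R i)) has_real_derivative u1 i s) (at s)"
    "\<And>i. i\<in>Basis \<Longrightarrow> (u1 i has_real_derivative d i) (at 0)" "L = (\<Sum>i\<in>Basis. d i)"
    unfolding line_laplacian_def by blast
  show ?thesis unfolding line_laplacian_def
  proof (intro exI[of _ "u1"] exI[of _ "d"] conjI ballI)
    fix i :: 'a assume i: "i \<in> Basis"
    have "open ((\<lambda>s::real. x + s *\<^sub>R i) -` S)"
      by (intro continuous_open_vimage assms continuous_intros)
    then have "\<forall>\<^sub>F s in nhds 0. s \<in> (\<lambda>s::real. x + s *\<^sub>R i) -` S"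
      by (rule eventually_nhds_in_open) (simp add: assms)
    then have "\<forall>\<^sub>F s in nhds 0. \<forall>\<^sub>F r in nhds s. u (x + r *\<^sub>R i) = v (x + r *\<^sub>R i)"
      by (subst eventually_eventually) (auto elim!: eventually_mono simp: assms)
    with u(1)[OF i]
    show "\<forall>\<^sub>F s in nhds 0. ((\<lambda>s. v (x + s *\<^sub>R i)) has_real_derivative u1 i s) (at s)"
      by eventually_elim (subst DERIV_cong_ev[symmetric, OF refl], auto)
  qed (use u in auto)
qed

text \<open>
  For a map \<open>\<sigma>\<close> that sends coordinate lines to parallel ones, moving along them with the constant
  speeds \<open>\<epsilon> i\<close> of equal modulus: translations, coordinate reflections and homotheties.
\<close>

lemma line_laplacian_comp:
  assumes "line_laplacian u (\<sigma> x) L"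
    and \<sigma>: "\<And>i s. i \<in> Basis \<Longrightarrow> \<sigma> (x + s *\<^sub>R i) = \<sigma> x + (s * \<epsilon> i) *\<^sub>R i"
    and \<epsilon>: "\<And>i. i \<in> Basis \<Longrightarrow> \<epsilon> i ^ 2 = \<rho>"
  shows "line_laplacian (\<lambda>x. u (\<sigma> x)) x (\<rho> * L)"
proof -
  from assms(1) obtain u1 d where u:
    "\<And>i. i\<in>Basis \<Longrightarrow> \<forall>\<^sub>F s in nhds 0. ((\<lambda>s. u (\<sigma> x + s *\<^sub>R i)) has_real_derivative u1 i s) (at s)"
    "\<And>i. i\<in>Basis \<Longrightarrow> (u1 i has_real_derivative d i) (at 0)" "L = (\<Sum>i\<in>Basis. d i)"
    unfolding line_laplacian_def by blast
  show ?thesis unfolding line_laplacian_def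
  proof (intro exI[of _ "\<lambda>i s. u1 i (s * \<epsilon> i) * \<epsilon> i"] exI[of _ "\<lambda>i. \<rho> * d i"] conjI ballI)
    fix i :: 'a assume i: "i \<in> Basis"
    have "((\<lambda>s. s * \<epsilon> i) \<longlongrightarrow> 0 * \<epsilon> i) (nhds 0)"
      by (intro tendsto_intros filterlim_ident)
    then have "filterlim (\<lambda>s. s * \<epsilon> i) (nhds 0) (nhds 0)" by simp
    from eventually_compose_filterlim[OF u(1)[OF i] this]
    show "\<forall>\<^sub>F s in nhds 0. ((\<lambda>s. u (\<sigma> (x + s *\<^sub>R i))) has_real_derivative u1 i (s * \<epsilon> i) * \<epsilon> i) (at s)"
      by eventually_elim
        (auto simp: \<sigma>[OF i] intro!: DERIV_chain2[where f="\<lambda>s. u (\<sigma> x + s *\<^sub>R i)"] derivative_eq_intros)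
    show "((\<lambda>s. u1 i (s * \<epsilon> i) * \<epsilon> i) has_real_derivative \<rho> * d i) (at 0)"
      using \<epsilon>[OF i] u(2)[OF i]
      by (auto intro!: DERIV_chain2[where f="u1 i"] derivative_eq_intros simp: power2_eq_square)
  qed (use u in \<open>auto simp: sum_distrib_left\<close>)
qed

lemma line_laplacianI:
  fixes v :: "'a::euclidean_space \<Rightarrow> real"
  assumes "open S" "x \<in> S"
    and "\<And>y. y \<in> S \<Longrightarrow> (v has_derivative v' y) (at y)"
    and "\<And>i. i \<in> Basis \<Longrightarrow> ((\<lambda>y. v' y i) has_derivative D i) (at x)"
  shows "line_laplacian v x (\<Sum>i\<in>Basis. D i i)"
  unfolding line_laplacian_def
proof (intro exI[of _ "\<lambda>i s. v' (x + s *\<^sub>R i) i"] exI[of _ "\<lambda>i. D i i"] conjI ballI refl)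
  fix i :: 'a assume i: "i \<in> Basis"
  have line: "((\<lambda>s. g (x + s *\<^sub>R i)) has_real_derivative G i) (at s)"
    if "(g has_derivative G) (at (x + s *\<^sub>R i))" for g :: "'a \<Rightarrow> real" and G s
  proof -
    have "((\<lambda>s. g (x + s *\<^sub>R i)) has_derivative (\<lambda>h. G (h *\<^sub>R i))) (at s)"
      by (rule has_derivative_compose[where f="\<lambda>s. x + s *\<^sub>R i"])
         (auto intro!: derivative_eq_intros that)
    moreover have "(\<lambda>h. G (h *\<^sub>R i)) = (*) (G i)"
      using linear_cmul[OF has_derivative_linear[OF that]] by (simp add: fun_eq_iff)
    ultimately show ?thesis by (simp add: has_field_derivative_def)
  qed
  have "open ((\<lambda>s::real. x + s *\<^sub>R i) -` S)"
    by (intro continuous_open_vimage assms continuous_intros)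
  then have "\<forall>\<^sub>F s in nhds 0. s \<in> (\<lambda>s::real. x + s *\<^sub>R i) -` S"
    by (rule eventually_nhds_in_open) (simp add: assms)
  then show "\<forall>\<^sub>F s in nhds 0. ((\<lambda>s. v (x + s *\<^sub>R i)) has_real_derivative v' (x + s *\<^sub>R i) i) (at s)"
  proof eventually_elim
    case (elim s)
    with assms(3) i show ?case by (intro line[where G="v' (x + s *\<^sub>R i)"]) auto
  qed
  show "((\<lambda>s. v' (x + s *\<^sub>R i) i) has_real_derivative D i i) (at 0)"
    using line[of "\<lambda>y. v' y i" "D i" 0] assms(4)[OF i] by simp
qed

lemma line_laplacian_norm_square:
  "line_laplacian (\<lambda>y::'a::euclidean_space. (y - c) \<bullet> (y - c)) x (2 * DIM('a))"
proof -
  have "line_laplacian (\<lambda>y::'a. (y - c) \<bullet> (y - c)) x (\<Sum>i\<in>Basis. (\<lambda>i h. 2 * (i \<bullet> h)) (i::'a) i)"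
    by (rule line_laplacianI[where S=UNIV and v'="\<lambda>y h. 2 * (h \<bullet> (y - c))" and D="\<lambda>i h. 2 * (i \<bullet> h)"])
       (auto intro!: derivative_eq_intros simp: inner_commute)
  moreover have "(\<Sum>i\<in>Basis. (\<lambda>i h. 2 * (i \<bullet> h)) (i::'a) i) = 2 * DIM('a)" by simp
  ultimately show ?thesis by metis
qed

text \<open>
  Otherwise \<open>g1\<close>, which vanishes at the maximum, would be positive immediately to the right of it,
  and \<open>g\<close> would increase there.
\<close>

lemma second_derivative_at_local_max:
  fixes g :: "real \<Rightarrow> real"
  assumes "\<forall>\<^sub>F s in nhds 0. (g has_real_derivative g1 s) (at s)"
    and "(g1 has_real_derivative d) (at 0)" and max: "\<forall>\<^sub>F s in nhds 0. g s \<le> g 0"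
  shows "d \<le> 0"
proof (rule ccontr)
  assume "\<not> d \<le> 0"
  obtain r where r: "r > 0" "\<And>s. \<bar>s\<bar> < r \<Longrightarrow> (g has_real_derivative g1 s) (at s)"
      "\<And>s. \<bar>s\<bar> < r \<Longrightarrow> g s \<le> g 0"
    using eventually_conj[OF assms(1) max] by (auto simp: eventually_nhds_metric dist_real_def)
  have "g1 0 = 0"
    using r by (intro DERIV_local_max[of g "g1 0" 0 r]) auto
  moreover obtain q where q: "q > 0" "\<And>h. 0 < h \<Longrightarrow> h < q \<Longrightarrow> g1 0 < g1 (0 + h)"
    using DERIV_pos_inc_right[OF assms(2)] \<open>\<not> d \<le> 0\<close> by auto
  ultimately have pos: "g1 h > 0" if "0 < h" "h < q" for h using that by force
  define s where "s = min q r / 2"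
  have s: "0 < s" "s < q" "s < r" using q r by (auto simp: s_def)
  have "g 0 < g s"
  proof (rule DERIV_pos_imp_increasing_open[OF s(1)])
    show "\<exists>y. (g has_real_derivative y) (at x) \<and> 0 < y" if "0 < x" "x < s" for x
      using that s r(2)[of x] pos[of x] by auto
    show "continuous_on {0..s} g"
      using s r(2) by (intro DERIV_continuous_on[where D=g1]) (auto intro: has_field_derivative_at_within)
  qed
  with r(3)[of s] s show False by simp
qed

text \<open>
  Perturbing \<open>v\<close> by a small multiple of the squared norm makes the Laplacian strictly positive,
  which is incompatible with an interior maximum, where every pure second derivative is
  nonpositive.
\<close>

lemma maximum_principle:
  fixes v :: "'a::euclidean_space \<Rightarrow> real"
  assumes U: "open U" "bounded U" and cont: "continuous_on (closure U) v"
    and lap: "\<And>x. x \<in> U \<Longrightarrow> \<exists>L\<ge>0. line_laplacian v x L"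
    and bd: "\<And>x. x \<in> closure U \<Longrightarrow> x \<notin> U \<Longrightarrow> v x \<le> M"
    and x: "x \<in> closure U"
  shows "v x \<le> M"
proof (rule ccontr)
  assume neg: "\<not> v x \<le> M"
  obtain R where R: "R > 0" "\<And>y. y \<in> closure U \<Longrightarrow> norm y \<le> R"
    using bounded_closure[OF U(2)] by (auto simp: bounded_pos)
  define e where "e = (v x - M) / (2 * R^2)"
  have e: "e > 0" "e * R^2 < v x - M" using neg R by (auto simp: e_def field_simps)
  define w where "w = (\<lambda>y. v y + e * ((y - 0) \<bullet> (y - 0)))"
  have sq: "y \<bullet> y \<le> R^2" if "y \<in> closure U" for y
    using R(2)[OF that] by (simp add: power2_norm_eq_inner[symmetric] power_mono)
  have "compact (closure U)" using U by (simp add: compact_closure)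
  moreover have "continuous_on (closure U) w"
    unfolding w_def by (intro continuous_intros cont)
  ultimately have "\<exists>m\<in>closure U. \<forall>y\<in>closure U. w y \<le> w m"
    using x by (intro continuous_attains_sup) auto
  then obtain m where m: "m \<in> closure U" "\<And>y. y \<in> closure U \<Longrightarrow> w y \<le> w m"
    by blast
  have "m \<in> U"
  proof (rule ccontr)
    assume "m \<notin> U"
    with bd m(1) have "v m \<le> M" by auto
    moreover have "e * (m \<bullet> m) \<le> e * R^2" using sq[OF m(1)] e by simp
    ultimately have "w m < v x" using e unfolding w_def diff_zero by linarith
    also have "v x \<le> w x" using e by (simp add: w_def)
    finally show False using m(2)[OF x] by simp
  qed
  obtain L where "L \<ge> 0" "line_laplacian v m L" using lap[OF \<open>m \<in> U\<close>] by auto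
  then have "line_laplacian w m (L + e * (2 * DIM('a)))"
    unfolding w_def by (intro line_laplacian_add line_laplacian_cmult line_laplacian_norm_square)
  then obtain w1 d where w:
    "\<And>i. i\<in>Basis \<Longrightarrow> \<forall>\<^sub>F s in nhds 0. ((\<lambda>s. w (m + s *\<^sub>R i)) has_real_derivative w1 i s) (at s)"
    "\<And>i. i\<in>Basis \<Longrightarrow> (w1 i has_real_derivative d i) (at 0)"
    "L + e * (2 * DIM('a)) = (\<Sum>i\<in>Basis. d i)"
    unfolding line_laplacian_def by blast
  have "d i \<le> 0" if i: "i \<in> Basis" for i
  proof (rule second_derivative_at_local_max[OF w(1,2)[OF i]])
    have "open ((\<lambda>s::real. m + s *\<^sub>R i) -` U)"
      by (intro continuous_open_vimage U continuous_intros)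
    then have "\<forall>\<^sub>F s in nhds 0. s \<in> (\<lambda>s::real. m + s *\<^sub>R i) -` U"
      by (rule eventually_nhds_in_open) (simp add: \<open>m \<in> U\<close>)
    then show "\<forall>\<^sub>F s in nhds 0. w (m + s *\<^sub>R i) \<le> w (m + 0 *\<^sub>R i)"
      by eventually_elim (use closure_subset[of U] in \<open>auto intro!: m(2)\<close>)
  qed
  then have "(\<Sum>i\<in>Basis. d i) \<le> 0" by (simp add: sum_nonpos)
  moreover have "e * (2 * DIM('a)) > 0" using e by simp
  ultimately show False using w(3) \<open>L \<ge> 0\<close> by linarith
qed

text \<open>
  With \<open>M = 0\<close> this is uniqueness for the Dirichlet problem, and for general \<open>M\<close> its stability.
\<close>

lemma weakly_harmonic_diff_bound:
  fixes u v :: "'a::euclidean_space \<Rightarrow> real"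
  assumes U: "open U" "bounded U"
    and cont: "continuous_on (closure U) u" "continuous_on (closure U) v"
    and lap: "\<And>x. x \<in> U \<Longrightarrow> line_laplacian u x 0" "\<And>x. x \<in> U \<Longrightarrow> line_laplacian v x 0"
    and bd: "\<And>x. x \<in> closure U \<Longrightarrow> x \<notin> U \<Longrightarrow> \<bar>u x - v x\<bar> \<le> M"
    and x: "x \<in> closure U"
  shows "\<bar>u x - v x\<bar> \<le> M"
proof -
  have "a x - b x \<le> M"
    if ab: "continuous_on (closure U) a" "continuous_on (closure U) b"
      "\<And>x. x \<in> U \<Longrightarrow> line_laplacian a x 0" "\<And>x. x \<in> U \<Longrightarrow> line_laplacian b x 0"
      "\<And>x. x \<in> closure U \<Longrightarrow> x \<notin> U \<Longrightarrow> a x - b x \<le> M" for a b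
  proof (rule maximum_principle[OF U, of "\<lambda>x. a x - b x"])
    show "continuous_on (closure U) (\<lambda>x. a x - b x)" by (intro continuous_on_diff ab)
    show "\<exists>L\<ge>0. line_laplacian (\<lambda>x. a x - b x) x L" if "x \<in> U" for x
      using line_laplacian_diff[OF ab(3,4)[OF that]] by auto
  qed (use ab(5) x in blast)+
  from this[of u v] this[of v u] show ?thesis
    using cont lap bd by (simp add: abs_le_iff)
qed

section \<open>Harmonic polynomials\<close>

text \<open>
  The counterparts of \<^const>\<open>partial_deriv\<close> and \<^const>\<open>laplacian\<close> for real-valued functions.
\<close>

definition pd :: "('a::euclidean_space \<Rightarrow> real) \<Rightarrow> 'a \<Rightarrow> 'a \<Rightarrow> real" where
  "pd f i x = frechet_derivative f (at x) i"

definition lap :: "('a::euclidean_space \<Rightarrow> real) \<Rightarrow> 'a \<Rightarrow> real" where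
  "lap f x = (\<Sum>i\<in>Basis. pd (pd f i) i x)"

lemma pd_eqI: "(f has_derivative D) (at x) \<Longrightarrow> pd f i x = D i"
  unfolding pd_def using frechet_derivative_at by metis

lemma real_polynomial_has_derivative:
  fixes p :: "'a::euclidean_space \<Rightarrow> real"
  assumes "real_polynomial_function p"
  shows "(p has_derivative frechet_derivative p (at x)) (at x)"
proof -
  from assms have "p differentiable (at x)"
    by (induction) (auto intro: bounded_linear_imp_differentiable)
  then show ?thesis by (simp add: frechet_derivative_works)
qed

lemma pd_linear: "bounded_linear f \<Longrightarrow> pd f i = (\<lambda>x. f i)"
  by (rule ext) (auto intro!: pd_eqI bounded_linear_imp_has_derivative)

lemma pd_const: "pd (\<lambda>x. c) i = (\<lambda>x. 0)"
  by (rule ext) (auto intro!: pd_eqI[of _ "\<lambda>_. 0"])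

lemma pd_add:
  assumes "real_polynomial_function p" "real_polynomial_function q"
  shows "pd (\<lambda>x. p x + q x) i = (\<lambda>x. pd p i x + pd q i x)"
  by (rule ext, rule trans[OF pd_eqI[OF has_derivative_add[OF assms[THEN real_polynomial_has_derivative]]]])
     (simp add: pd_def)

lemma pd_mult:
  assumes "real_polynomial_function p" "real_polynomial_function q"
  shows "pd (\<lambda>x. p x * q x) i = (\<lambda>x. pd p i x * q x + p x * pd q i x)"
  by (rule ext, rule trans[OF pd_eqI[OF has_derivative_mult[OF assms[THEN real_polynomial_has_derivative]]]])
     (simp add: pd_def)

lemma pd_cmult:
  assumes "real_polynomial_function p"
  shows "pd (\<lambda>x. c * p x) i = (\<lambda>x. c * pd p i x)"
  using pd_mult[OF real_polynomial_function.intros(2)[of c] assms] by (simp add: pd_const)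

lemma real_polynomial_pd:
  "real_polynomial_function p \<Longrightarrow> real_polynomial_function (pd p i)"
  by (induction rule: real_polynomial_function.induct)
     (auto simp: pd_linear pd_const pd_add pd_mult intro: real_polynomial_function.intros)

lemma real_polynomial_lap:
  "real_polynomial_function p \<Longrightarrow> real_polynomial_function (lap p)"
  unfolding lap_def[abs_def] by (auto intro!: real_polynomial_function_sum real_polynomial_pd)

lemma pd_sum:
  assumes "finite I" "\<And>j. j \<in> I \<Longrightarrow> real_polynomial_function (p j)"
  shows "pd (\<lambda>x. \<Sum>j\<in>I. p j x) i = (\<lambda>x. \<Sum>j\<in>I. pd (p j) i x)"
  using assms
  by (induction rule: finite_induct) (auto simp: pd_const pd_add real_polynomial_function_sum)

text \<open>
  For polynomials the symmetry of second derivatives follows from the product rule alone. It makes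
  the derivatives of a harmonic polynomial harmonic.
\<close>

lemma pd_commute:
  "real_polynomial_function p \<Longrightarrow> pd (pd p i) j = pd (pd p j) i"
proof (induction rule: real_polynomial_function.induct)
  case (mult f g)
  then show ?case
    by (simp add: pd_mult pd_add real_polynomial_pd real_polynomial_function.intros(4) fun_eq_iff algebra_simps)
qed (auto simp: pd_linear pd_const pd_add real_polynomial_pd)

lemma lap_pd:
  assumes "real_polynomial_function p"
  shows "lap (pd p i) = pd (lap p) i"
proof -
  have "pd (pd (pd p i) j) j = pd (pd (pd p j) j) i" for j
    by (simp only: pd_commute[OF assms, of i j] pd_commute[OF real_polynomial_pd[OF assms], of j i j])
  then have "lap (pd p i) = (\<lambda>x. \<Sum>j\<in>Basis. pd (pd (pd p j) j) i x)"
    by (simp add: lap_def[abs_def])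
  also have "\<dots> = pd (lap p) i"
    unfolding lap_def[abs_def] by (subst pd_sum) (auto intro!: real_polynomial_pd assms)
  finally show ?thesis .
qed

lemma lap_add:
  assumes "real_polynomial_function p" "real_polynomial_function q"
  shows "lap (\<lambda>x. p x + q x) = (\<lambda>x. lap p x + lap q x)"
  using assms by (simp add: lap_def[abs_def] pd_add real_polynomial_pd sum.distrib)

lemma lap_cmult:
  assumes "real_polynomial_function p"
  shows "lap (\<lambda>x. c * p x) = (\<lambda>x. c * lap p x)"
  using assms by (simp add: lap_def[abs_def] pd_cmult real_polynomial_pd sum_distrib_left)

lemma lap_mult:
  assumes "real_polynomial_function p" "real_polynomial_function q"
  shows "lap (\<lambda>x. p x * q x) x = lap p x * q x + 2 * (\<Sum>i\<in>Basis. pd p i x * pd q i x) + p x * lap q x"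
  using assms
  by (simp add: lap_def[abs_def] pd_add pd_mult real_polynomial_pd real_polynomial_function.intros(4)
      sum.distrib sum_distrib_left sum_distrib_right algebra_simps)

lemma real_polynomial_affine:
  assumes "real_polynomial_function p"
  shows "real_polynomial_function (\<lambda>x. p (a + c *\<^sub>R x))"
proof -
  have "polynomial_function (\<lambda>x. a + c *\<^sub>R x)"
    by (intro polynomial_function_add polynomial_function_cmul) auto
  from real_polynomial_function_compose[OF this assms] show ?thesis by (simp add: o_def)
qed

lemma pd_affine:
  assumes "real_polynomial_function p"
  shows "pd (\<lambda>x. p (a + c *\<^sub>R x)) i = (\<lambda>x. c * pd p i (a + c *\<^sub>R x))"
proof
  fix x
  have "((\<lambda>x. p (a + c *\<^sub>R x)) has_derivative (\<lambda>h. frechet_derivative p (at (a + c *\<^sub>R x)) (c *\<^sub>R h))) (at x)"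
    by (rule has_derivative_compose[where f="\<lambda>x. a + c *\<^sub>R x"])
       (auto intro!: derivative_eq_intros real_polynomial_has_derivative assms)
  from pd_eqI[OF this] show "pd (\<lambda>x. p (a + c *\<^sub>R x)) i x = c * pd p i (a + c *\<^sub>R x)"
    using linear_cmul[OF has_derivative_linear[OF real_polynomial_has_derivative[OF assms]]]
    by (simp add: pd_def)
qed

lemma lap_affine:
  assumes "real_polynomial_function p"
  shows "lap (\<lambda>x. p (a + c *\<^sub>R x)) x = c^2 * lap p (a + c *\<^sub>R x)"
  unfolding lap_def using assms
  by (simp add: pd_affine pd_cmult real_polynomial_pd real_polynomial_affine sum_distrib_left
      power2_eq_square mult.assoc)

lemma real_polynomial_line_laplacian:
  assumes "real_polynomial_function p"
  shows "line_laplacian p x (lap p x)"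
proof -
  have "line_laplacian p x (\<Sum>i\<in>Basis. frechet_derivative (pd p i) (at x) i)"
  proof (rule line_laplacianI[where S=UNIV and v'="\<lambda>y. frechet_derivative p (at y)"
        and D="\<lambda>i. frechet_derivative (pd p i) (at x)"])
    fix i :: 'a
    show "((\<lambda>y. frechet_derivative p (at y) i) has_derivative frechet_derivative (pd p i) (at x)) (at x)"
      using real_polynomial_has_derivative[OF real_polynomial_pd[OF assms]] by (simp add: pd_def[abs_def])
  qed (auto intro: real_polynomial_has_derivative assms)
  then show ?thesis by (simp add: lap_def pd_def)
qed

lemma continuous_on_real_polynomial: "real_polynomial_function p \<Longrightarrow> continuous_on S p"
  using continuous_on_polymonial_function real_polynomial_function_eq by metis

text \<open>
  Homogeneity is a scaling property here, so that products, derivatives and Laplacians need no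
  monomials. Restricting it to \<open>c > 0\<close> allows powers of \<open>c\<close> to be cancelled.
\<close>

definition homogeneous :: "nat \<Rightarrow> ('a::euclidean_space \<Rightarrow> real) \<Rightarrow> bool" where
  "homogeneous m p \<longleftrightarrow> real_polynomial_function p \<and> (\<forall>c>0. \<forall>x. p (c *\<^sub>R x) = c ^ m * p x)"

text \<open>
  Euler's relation: differentiate \<open>p (c x) = c\<^sup>m p x\<close> at \<open>c = 1\<close>.
\<close>

lemma homogeneous_euler:
  fixes p :: "'a::euclidean_space \<Rightarrow> real"
  assumes "homogeneous m p"
  shows "(\<Sum>i\<in>Basis. (x \<bullet> i) * pd p i x) = m * p x"
proof -
  let ?D = "frechet_derivative p (at x)"
  have D: "(p has_derivative ?D) (at (1 *\<^sub>R x))"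
    using assms by (simp add: homogeneous_def real_polynomial_has_derivative)
  have lin: "linear ?D" using has_derivative_linear[OF D] .
  have "((\<lambda>c. p (c *\<^sub>R x)) has_derivative (\<lambda>h. ?D (h *\<^sub>R x))) (at 1)"
    by (rule has_derivative_compose[where f="\<lambda>c. c *\<^sub>R x", OF _ D]) (auto intro!: derivative_eq_intros)
  then have "((\<lambda>c. c ^ m * p x) has_derivative (\<lambda>h. ?D (h *\<^sub>R x))) (at 1)"
    by (rule has_derivative_transform_within_open[where s="{0<..}"])
       (use assms in \<open>auto simp: homogeneous_def\<close>)
  moreover have "((\<lambda>c. c ^ m * p x) has_derivative (\<lambda>h. h * (m * p x))) (at 1)"
    by (auto intro!: derivative_eq_intros)
  ultimately have "?D (1 *\<^sub>R x) = 1 * (m * p x)"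
    using has_derivative_unique by metis
  moreover have "?D x = (\<Sum>i\<in>Basis. (x \<bullet> i) * pd p i x)"
    by (subst euclidean_representation[of x, symmetric]) (simp add: linear_sum[OF lin] linear_cmul[OF lin] pd_def)
  ultimately show ?thesis by simp
qed

lemma lap_homogeneous_scale:
  assumes "homogeneous m p" "c > 0"
  shows "c^2 * lap p (c *\<^sub>R x) = c ^ m * lap p x"
proof -
  have p: "real_polynomial_function p" and "(\<lambda>x. p (0 + c *\<^sub>R x)) = (\<lambda>x. c ^ m * p x)"
    using assms by (auto simp: homogeneous_def)
  then have "lap (\<lambda>x. p (0 + c *\<^sub>R x)) x = lap (\<lambda>x. c ^ m * p x) x" by simp
  with lap_affine[OF p, of 0 c x] lap_cmult[OF p, of "c^m"] show ?thesis by simp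
qed

lemma homogeneous_lap:
  assumes "homogeneous m p" "m \<ge> 2"
  shows "homogeneous (m - 2) (lap p)"
proof -
  have "lap p (c *\<^sub>R x) = c ^ (m - 2) * lap p x" if "c > 0" for c x
  proof -
    have "c ^ m = c^2 * c ^ (m - 2)" using power_add[of c 2 "m - 2"] assms(2)
      by (simp only: le_add_diff_inverse)
    with lap_homogeneous_scale[OF assms(1) that, of x] that show ?thesis by simp
  qed
  with assms show ?thesis by (auto simp: homogeneous_def real_polynomial_lap)
qed

text \<open>
  The Laplacian scales with the exponent \<open>m - 2 < 0\<close> but stays bounded near the origin, so it
  vanishes.
\<close>

lemma lap_homogeneous_eq_0:
  assumes "homogeneous m p" "m < 2"
  shows "lap p x = 0"
proof -
  have "continuous_on UNIV (\<lambda>c. c ^ (2 - m) * lap p (c *\<^sub>R x))"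
    using assms by (auto simp: homogeneous_def intro!: continuous_intros
        continuous_on_compose2[OF continuous_on_real_polynomial[OF real_polynomial_lap]])
  then have "((\<lambda>c. c ^ (2 - m) * lap p (c *\<^sub>R x)) \<longlongrightarrow> 0 ^ (2 - m) * lap p (0 *\<^sub>R x)) (at_right 0)"
    by (meson continuous_on_def UNIV_I tendsto_within_subset top_greatest)
  moreover have "c ^ (2 - m) * lap p (c *\<^sub>R x) = lap p x" if "c > 0" for c
  proof -
    have "c^2 = c ^ m * c ^ (2 - m)" using assms(2) by (simp flip: power_add)
    with lap_homogeneous_scale[OF assms(1) that, of x] that show ?thesis by simp
  qed
  then have "\<forall>\<^sub>F c in at_right 0. c ^ (2 - m) * lap p (c *\<^sub>R x) = lap p x"
    by (simp add: eventually_at_right_less eventually_mono[OF eventually_at_right_less])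
  ultimately have "((\<lambda>c::real. lap p x) \<longlongrightarrow> 0) (at_right 0)"
    using assms(2) by (auto simp: zero_power elim!: Lim_transform_eventually)
  then show ?thesis by (simp add: tendsto_const_iff)
qed

lemma homogeneous_add: "homogeneous m p \<Longrightarrow> homogeneous m q \<Longrightarrow> homogeneous m (\<lambda>x. p x + q x)"
  by (auto simp: homogeneous_def algebra_simps)

lemma homogeneous_cmult: "homogeneous m p \<Longrightarrow> homogeneous m (\<lambda>x. c * p x)"
  by (auto simp: homogeneous_def algebra_simps)

lemma homogeneous_mult:
  "homogeneous m p \<Longrightarrow> homogeneous k q \<Longrightarrow> homogeneous (m + k) (\<lambda>x. p x * q x)"
  by (auto simp: homogeneous_def algebra_simps power_add)

lemma norm_square_polynomial: "real_polynomial_function (\<lambda>x::'a::euclidean_space. x \<bullet> x)"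
proof -
  have "(\<lambda>x::'a. x \<bullet> x) = (\<lambda>x. \<Sum>i\<in>Basis. (x \<bullet> i) * (x \<bullet> i))"
    by (rule ext, rule euclidean_inner)
  moreover have "real_polynomial_function (\<lambda>x::'a. \<Sum>i\<in>Basis. (x \<bullet> i) * (x \<bullet> i))"
    by (intro real_polynomial_function_sum real_polynomial_function.intros(4)
        real_polynomial_function.intros(1)[OF bounded_linear_inner_left]) auto
  ultimately show ?thesis by simp
qed

lemma pd_norm_square: "pd (\<lambda>x::'a::euclidean_space. x \<bullet> x) i = (\<lambda>x. 2 * (x \<bullet> i))"
proof
  fix x :: 'a
  have "((\<lambda>x. x \<bullet> x) has_derivative (\<lambda>h. 2 * (x \<bullet> h))) (at x)"
    by (auto intro!: derivative_eq_intros simp: inner_commute)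
  from pd_eqI[OF this] show "pd (\<lambda>x. x \<bullet> x) i x = 2 * (x \<bullet> i)" .
qed

lemma lap_norm_square: "lap (\<lambda>x::'a::euclidean_space. x \<bullet> x) = (\<lambda>x. 2 * DIM('a))"
proof -
  have "pd (\<lambda>x::'a. 2 * (x \<bullet> i)) i x = 2 * (i \<bullet> i)" for i x
    by (subst pd_linear) (auto intro: bounded_linear_mult_right[THEN bounded_linear_compose] bounded_linear_inner_left)
  then show ?thesis by (simp add: lap_def pd_norm_square fun_eq_iff)
qed

lemma homogeneous_norm_square: "homogeneous 2 (\<lambda>x. x \<bullet> x)"
  by (simp add: homogeneous_def norm_square_polynomial power2_eq_square)

lemma lap_norm_square_mult:
  fixes q :: "'a::euclidean_space \<Rightarrow> real"
  assumes "homogeneous m q"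
  shows "lap (\<lambda>x. (x \<bullet> x) * q x) x = (2 * DIM('a) + 4 * m) * q x + (x \<bullet> x) * lap q x"
proof -
  have "(\<Sum>i\<in>Basis. 2 * (x \<bullet> i) * pd q i x) = 2 * (m * q x)"
    unfolding homogeneous_euler[OF assms, of x, symmetric] by (simp add: sum_distrib_left mult.assoc)
  with assms show ?thesis
    by (simp add: lap_mult homogeneous_def norm_square_polynomial lap_norm_square pd_norm_square algebra_simps)
qed

text \<open>
  Up to multiples of \<open>|x|\<^sup>2\<close> the operator is multiplication by \<open>c\<close>: the first approximation
  \<open>p / c\<close> leaves an error divisible by \<open>|x|\<^sup>2\<close>, and cancelling that factor leads to the same
  equation two degrees lower, with a larger constant.
\<close>

lemma solve_norm_square_lap:
  fixes p :: "'a::euclidean_space \<Rightarrow> real"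
  assumes "homogeneous m p" "c > 0"
  shows "\<exists>q. homogeneous m q \<and> (\<forall>x. (x \<bullet> x) * lap q x + c * q x = p x)"
  using assms
proof (induction m arbitrary: p c rule: less_induct)
  case (less m)
  have p: "real_polynomial_function p" using less.prems by (simp add: homogeneous_def)
  show ?case
  proof (cases "m < 2")
    case True
    have "lap (\<lambda>x. 1/c * p x) x = 0" for x
      by (rule lap_homogeneous_eq_0[OF homogeneous_cmult[OF less.prems(1)] True])
    then show ?thesis using less.prems
      by (intro exI[of _ "\<lambda>x. 1/c * p x"] conjI homogeneous_cmult) auto
  next
    case False
    define c' where "c' = c + (2 * DIM('a) + 4 * (m - 2))"
    have "c' > 0" using less.prems by (simp add: c'_def add_pos_nonneg)
    have "homogeneous (m - 2) (\<lambda>x. (-1/c) * lap p x)"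
      using False less.prems by (intro homogeneous_cmult homogeneous_lap) auto
    with less.IH[OF _ this \<open>c' > 0\<close>] False
    obtain s where s: "homogeneous (m - 2) s"
        "\<And>x. (x \<bullet> x) * lap s x + c' * s x = (-1/c) * lap p x"
      by auto
    define q where "q = (\<lambda>x. 1/c * p x + (x \<bullet> x) * s x)"
    have "homogeneous (2 + (m - 2)) (\<lambda>x. (x \<bullet> x) * s x)"
      by (intro homogeneous_mult homogeneous_norm_square s)
    moreover have "2 + (m - 2) = m" using False by simp
    ultimately have hs: "homogeneous m (\<lambda>x. (x \<bullet> x) * s x)" by metis
    then have "homogeneous m q"
      unfolding q_def by (intro homogeneous_add homogeneous_cmult less.prems)
    moreover have "(x \<bullet> x) * lap q x + c * q x = p x" for x
    proof -
      have "lap q x = 1/c * lap p x + lap (\<lambda>x. (x \<bullet> x) * s x) x"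
        using lap_add[OF homogeneous_cmult[OF less.prems(1), of "1/c", unfolded homogeneous_def, THEN conjunct1]
            hs[unfolded homogeneous_def, THEN conjunct1]] lap_cmult[OF p, of "1/c"]
        unfolding q_def by simp
      also have "\<dots> = 1/c * lap p x + ((c' - c) * s x + (x \<bullet> x) * lap s x)"
        by (simp add: lap_norm_square_mult[OF s(1)] c'_def)
      also have "\<dots> = - c * s x" using s(2)[of x] by (simp add: algebra_simps)
      finally show ?thesis using less.prems by (simp add: q_def algebra_simps)
    qed
    ultimately show ?thesis by blast
  qed
qed

definition harmonic_polynomial :: "('a::euclidean_space \<Rightarrow> real) \<Rightarrow> bool" where
  "harmonic_polynomial p \<longleftrightarrow> real_polynomial_function p \<and> (\<forall>x. lap p x = 0)"

lemma harmonic_polynomial_add: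
  "harmonic_polynomial p \<Longrightarrow> harmonic_polynomial q \<Longrightarrow> harmonic_polynomial (\<lambda>x. p x + q x)"
  by (auto simp: harmonic_polynomial_def lap_add)

text \<open>
  If \<open>lap (|x|\<^sup>2 q) = lap p\<close> then \<open>p - |x|\<^sup>2 q\<close> is harmonic and differs from \<open>p\<close> on the unit sphere
  only by \<open>q\<close>, which has lower degree and is treated by induction.
\<close>

lemma homogeneous_on_sphere_eq_harmonic:
  fixes p :: "'a::euclidean_space \<Rightarrow> real"
  assumes "homogeneous m p"
  shows "\<exists>q. harmonic_polynomial q \<and> (\<forall>x. x \<bullet> x = 1 \<longrightarrow> q x = p x)"
  using assms
proof (induction m arbitrary: p rule: less_induct)
  case (less m)
  have p: "real_polynomial_function p" using less.prems by (simp add: homogeneous_def)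
  show ?case
  proof (cases "m < 2")
    case True
    with lap_homogeneous_eq_0[OF less.prems] p show ?thesis
      by (auto simp: harmonic_polynomial_def)
  next
    case False
    \<comment> \<open>With this constant the solved equation reads \<open>lap (|x|\<^sup>2 q) = lap p\<close>.\<close>
    define c where "c = real (2 * DIM('a) + 4 * (m - 2))"
    have "c > 0" by (simp add: c_def add_pos_nonneg)
    from solve_norm_square_lap[OF homogeneous_lap[OF less.prems] this] False
    obtain q where q: "homogeneous (m - 2) q" "\<And>x. (x \<bullet> x) * lap q x + c * q x = lap p x"
      by auto
    obtain r where r: "harmonic_polynomial r" "\<And>x. x \<bullet> x = 1 \<Longrightarrow> r x = q x"
      using less.IH[OF _ q(1)] False by auto
    have rq: "real_polynomial_function (\<lambda>x. (x \<bullet> x) * q x)"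
      using q(1) by (intro real_polynomial_function.intros(4) norm_square_polynomial) (simp add: homogeneous_def)
    define h where "h = (\<lambda>x. p x + (-1) * ((x \<bullet> x) * q x))"
    have "lap h x = lap p x + (-1) * lap (\<lambda>x. (x \<bullet> x) * q x) x" for x
      unfolding h_def
      by (subst lap_add[OF p]) (use rq lap_cmult[OF rq, of "-1"] in \<open>auto intro: real_polynomial_function.intros\<close>)
    then have "lap h x = lap p x - ((x \<bullet> x) * lap q x + c * q x)" for x
      unfolding lap_norm_square_mult[OF q(1)] c_def by simp
    then have "lap h x = 0" for x using q(2)[of x] by simp
    then have "harmonic_polynomial h"
      using p rq by (auto simp: harmonic_polynomial_def h_def)
    from harmonic_polynomial_add[OF this r(1)] r(2) show ?thesis
      by (intro exI[of _ "\<lambda>x. h x + r x"]) (auto simp: h_def)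
  qed
qed

inductive sum_of_homogeneous :: "('a::euclidean_space \<Rightarrow> real) \<Rightarrow> bool" where
  homogeneous: "homogeneous m p \<Longrightarrow> sum_of_homogeneous p"
| add: "sum_of_homogeneous p \<Longrightarrow> sum_of_homogeneous q \<Longrightarrow> sum_of_homogeneous (\<lambda>x. p x + q x)"

lemma sum_of_homogeneous_mult:
  assumes "sum_of_homogeneous p" "sum_of_homogeneous q"
  shows "sum_of_homogeneous (\<lambda>x. p x * q x)"
  using assms
proof (induction arbitrary: q)
  case (homogeneous m p)
  from homogeneous.prems homogeneous.hyps show ?case
  proof induction
    case (homogeneous k q)
    then show ?case using homogeneous_mult sum_of_homogeneous.homogeneous by blast
  next
    case (add q r)
    then show ?case using sum_of_homogeneous.add by (force simp: distrib_left)
  qed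
next
  case (add p r)
  then show ?case using sum_of_homogeneous.add by (force simp: distrib_right)
qed

lemma real_polynomial_sum_of_homogeneous:
  "real_polynomial_function p \<Longrightarrow> sum_of_homogeneous p"
proof (induction rule: real_polynomial_function.induct)
  case (linear f)
  then have "homogeneous 1 f"
    by (auto simp: homogeneous_def linear_simps intro: real_polynomial_function.intros(1))
  then show ?case by (rule sum_of_homogeneous.homogeneous)
next
  case (const c)
  have "homogeneous 0 (\<lambda>x. c)" by (simp add: homogeneous_def real_polynomial_function.intros(2))
  then show ?case by (rule sum_of_homogeneous.homogeneous)
qed (auto intro: sum_of_homogeneous.add sum_of_homogeneous_mult)

theorem polynomial_dirichlet_problem:
  fixes p :: "'a::euclidean_space \<Rightarrow> real"
  assumes "real_polynomial_function p"
  shows "\<exists>q. harmonic_polynomial q \<and> (\<forall>x. x \<bullet> x = 1 \<longrightarrow> q x = p x)"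
  using real_polynomial_sum_of_homogeneous[OF assms]
proof induction
  case (homogeneous m p)
  then show ?case by (rule homogeneous_on_sphere_eq_harmonic)
next
  case (add p q)
  then show ?case using harmonic_polynomial_add by metis
qed

section \<open>Interior gradient estimate\<close>

text \<open>
  Bernstein's method: with the cut-off \<open>\<phi> = 1 - |x|\<^sup>2\<close> and \<open>w\<close> a first derivative of \<open>u\<close>, the
  function \<open>\<phi>\<^sup>2 w\<^sup>2 + A u\<^sup>2\<close> is subharmonic on the unit ball once \<open>A \<ge> 2n + 12\<close>. The cross term
  \<open>8 \<phi> w \<nabla>\<phi> \<cdot> \<nabla>w\<close> is absorbed by completing a square against \<open>2 \<phi>\<^sup>2 |\<nabla>w|\<^sup>2\<close>, and everything
  that remains is at least \<open>- (4n + 24) w\<^sup>2\<close>, which \<open>lap (A u\<^sup>2) = 2 A |\<nabla>u|\<^sup>2\<close> dominates. Since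
  \<open>\<phi>\<close> vanishes on the sphere, the maximum principle bounds \<open>w 0\<close> by the size of \<open>u\<close> there.
\<close>

lemma gradient_estimate_unit_ball:
  fixes u :: "'a::euclidean_space \<Rightarrow> real" and M :: real
  assumes u: "harmonic_polynomial u" and bd: "\<And>x. norm x \<le> 1 \<Longrightarrow> \<bar>u x\<bar> \<le> M" and e: "e \<in> Basis"
  shows "(pd u e 0)^2 \<le> (2 * DIM('a) + 12) * M^2"
proof -
  define n where "n = real DIM('a)"
  define A where "A = 2 * n + 12"
  define w where "w = pd u e"
  define \<phi> where "\<phi> = (\<lambda>x::'a. 1 + (-1) * (x \<bullet> x))"
  define G where "G = (\<lambda>x. (\<phi> x * \<phi> x) * (w x * w x) + A * (u x * u x))"
  note rpf = real_polynomial_function.intros(2) real_polynomial_function.intros(3) real_polynomial_function.intros(4)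
    real_polynomial_pd norm_square_polynomial
  have pu: "real_polynomial_function u" and lu: "\<And>x. lap u x = 0"
    using u by (auto simp: harmonic_polynomial_def)
  have pw: "real_polynomial_function w" using pu by (simp add: w_def real_polynomial_pd)
  have lw: "lap w x = 0" for x
  proof -
    have "lap u = (\<lambda>x. 0)" using lu by auto
    then show ?thesis by (simp add: w_def lap_pd[OF pu] pd_const)
  qed
  have p\<phi>: "real_polynomial_function \<phi>" unfolding \<phi>_def by (intro rpf)
  have d\<phi>: "pd \<phi> i x = - 2 * (x \<bullet> i)" for i x
    unfolding \<phi>_def pd_add[OF rpf(1) rpf(3)[OF rpf(1) rpf(5)]] pd_cmult[OF norm_square_polynomial]
    by (simp add: pd_const pd_norm_square)
  have "lap (\<lambda>x::'a. 1) = (\<lambda>x. 0)" by (simp add: lap_def[abs_def] pd_const)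
  then have l\<phi>: "lap \<phi> x = - 2 * n" for x
    using lap_add[where 'a='a, OF rpf(1) rpf(3)[OF rpf(1) rpf(5)], of 1 "-1"] lap_cmult[OF norm_square_polynomial[where 'a='a], of "-1"]
    by (simp add: \<phi>_def n_def lap_norm_square)
  have pG: "real_polynomial_function G" 
    unfolding G_def
    by (rule rpf(2)[OF rpf(3)[OF rpf(3)[OF p\<phi> p\<phi>] rpf(3)[OF pw pw]] rpf(3)[OF rpf(1) rpf(3)[OF pu pu]]])
  have subharmonic: "lap G x \<ge> 0" if "norm x \<le> 1" for x
  proof -
    define W where "W = (\<Sum>i\<in>Basis. (pd w i x)^2)"
    define U where "U = (\<Sum>i\<in>Basis. (pd u i x)^2)"
    define C where "C = (\<Sum>i\<in>Basis. pd \<phi> i x * pd w i x)"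
    define P where "P = (\<Sum>i\<in>Basis. (pd \<phi> i x)^2)"
    have xx: "0 \<le> x \<bullet> x" "x \<bullet> x \<le> 1"
      using that by (auto simp: power2_norm_eq_inner[symmetric] power_le_one)
    have P: "P = 4 * (x \<bullet> x)"
      unfolding P_def d\<phi> euclidean_inner[of x x]
      by (simp add: power2_eq_square sum_distrib_left algebra_simps)
    have "lap (\<lambda>x. w x * w x) x = 2 * W"
      by (simp add: lap_mult pw lw W_def power2_eq_square)
    moreover have "lap (\<lambda>x. u x * u x) x = 2 * U"
      by (simp add: lap_mult pu lu U_def power2_eq_square)
    moreover have "lap (\<lambda>x. \<phi> x * \<phi> x) x = - 4 * n * \<phi> x + 2 * P"
      by (simp add: lap_mult p\<phi> l\<phi> P_def power2_eq_square)
    moreover have "(\<Sum>i\<in>Basis. pd (\<lambda>x. \<phi> x * \<phi> x) i x * pd (\<lambda>x. w x * w x) i x) = 4 * \<phi> x * w x * C"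
      by (simp add: pd_mult p\<phi> pw C_def sum_distrib_left algebra_simps)
    moreover have "lap G x = lap (\<lambda>x. (\<phi> x * \<phi> x) * (w x * w x)) x + A * lap (\<lambda>x. u x * u x) x"
      unfolding G_def by (simp add: lap_add lap_cmult rpf pu pw p\<phi>)
    moreover note lap_mult[OF rpf(3)[OF p\<phi> p\<phi>] rpf(3)[OF pw pw], of x]
    ultimately have "lap G x = (- 4 * n * \<phi> x + 2 * P) * (w x)^2 + 8 * \<phi> x * w x * C
        + 2 * (\<phi> x)^2 * W + 2 * A * U"
      by algebra
    \<comment> \<open>Completing the square that absorbs the cross term.\<close>
    moreover have "0 \<le> 2 * (\<Sum>i\<in>Basis. (\<phi> x * pd w i x + 2 * w x * pd \<phi> i x)^2)"
      by (simp add: sum_nonneg)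
    then have "0 \<le> 2 * (\<phi> x)^2 * W + 8 * \<phi> x * w x * C + 8 * (w x)^2 * P"
      by (simp add: W_def C_def P_def power2_eq_square algebra_simps sum.distrib sum_distrib_left)
    moreover have "(w x)^2 \<le> U"
      unfolding U_def w_def by (intro member_le_sum e) auto
    then have "2 * A * (w x)^2 \<le> 2 * A * U" by (intro mult_left_mono) (auto simp: A_def n_def)
    moreover have "0 \<le> (- 4 * n * \<phi> x - 6 * P + 2 * A) * (w x)^2"
    proof (rule mult_nonneg_nonneg)
      have "n * \<phi> x \<le> n * 1" using xx by (intro mult_left_mono) (auto simp: \<phi>_def n_def)
      then show "0 \<le> - 4 * n * \<phi> x - 6 * P + 2 * A" using xx by (simp add: A_def P)
    qed simp
    ultimately show ?thesis by (simp add: algebra_simps)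
  qed
  have M: "(u x)^2 \<le> M^2" if "norm x \<le> 1" for x
    using bd[OF that] by (metis abs_ge_zero power2_abs power_mono)
  have "G 0 \<le> A * M^2"
  proof (rule maximum_principle[of "ball 0 1" G "A * M^2" 0])
    show "\<exists>L\<ge>0. line_laplacian G x L" if "x \<in> ball 0 1" for x
      using real_polynomial_line_laplacian[OF pG, of x] subharmonic[of x] that by auto
    show "G x \<le> A * M\<^sup>2" if "x \<in> closure (ball 0 1)" "x \<notin> ball 0 1" for x
    proof -
      have "norm x = 1" using that by simp
      then have "\<phi> x = 0" by (simp add: \<phi>_def norm_eq_1)
      with M[of x] \<open>norm x = 1\<close> show ?thesis by (simp add: G_def A_def n_def power2_eq_square mult_left_mono)
    qed
  qed (auto intro: continuous_on_real_polynomial pG)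
  moreover have "(pd u e 0)^2 \<le> G 0"
    by (simp add: G_def \<phi>_def w_def power2_eq_square A_def n_def)
  ultimately show ?thesis by (simp add: A_def n_def)
qed

text \<open>The estimate at the origin, transported by \<open>y \<mapsto> x + r y\<close>.\<close>

lemma gradient_estimate:
  fixes u :: "'a::euclidean_space \<Rightarrow> real" and M :: real
  assumes u: "harmonic_polynomial u" and bd: "\<And>y. y \<in> cball x r \<Longrightarrow> \<bar>u y\<bar> \<le> M"
    and e: "e \<in> Basis" and r: "r > 0"
  shows "\<bar>pd u e x\<bar> \<le> (2 * DIM('a) + 12) * M / r"
proof -
  define A where "A = real (2 * DIM('a) + 12)"
  have "\<bar>u x\<bar> \<le> M" using bd r by simp
  then have "M \<ge> 0" by linarith
  have pu: "real_polynomial_function u" using u by (simp add: harmonic_polynomial_def)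
  have "(pd (\<lambda>y. u (x + r *\<^sub>R y)) e 0)^2 \<le> A * M^2"
    unfolding A_def
  proof (rule gradient_estimate_unit_ball[OF _ _ e])
    show "harmonic_polynomial (\<lambda>y. u (x + r *\<^sub>R y))"
      using u by (auto simp: harmonic_polynomial_def lap_affine real_polynomial_affine)
    show "\<bar>u (x + r *\<^sub>R y)\<bar> \<le> M" if "norm y \<le> 1" for y
      using that r by (intro bd) (auto simp: dist_norm)
  qed
  also have "A * M^2 \<le> A^2 * M^2"
    by (intro mult_right_mono) (auto simp: A_def power2_eq_square)
  finally have "(r * pd u e x)^2 \<le> (A * M)^2" by (simp add: pd_affine[OF pu] power_mult_distrib)
  then have "\<bar>r * pd u e x\<bar> \<le> A * M"
    using \<open>M \<ge> 0\<close> by (simp add: A_def abs_le_square_iff[symmetric])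
  then show ?thesis using r by (simp add: A_def abs_mult field_simps)
qed

section \<open>Regularity: weakly harmonic functions are limits of harmonic polynomials\<close>

text \<open>
  Local uniform approximability by harmonic polynomials is the form in which harmonicity implies
  smoothness: it is inherited by all partial derivatives (\<open>harmonic_approx_pd\<close>).
\<close>

definition harmonic_approx :: "'a::euclidean_space set \<Rightarrow> ('a \<Rightarrow> real) \<Rightarrow> bool" where
  "harmonic_approx S v \<longleftrightarrow> (\<forall>x\<in>S. \<exists>r>0. \<exists>P.
     (\<forall>k::nat. harmonic_polynomial (P k)) \<and> uniform_limit (ball x r) P v sequentially)"

lemma harmonic_polynomial_pd: "harmonic_polynomial p \<Longrightarrow> harmonic_polynomial (pd p i)"
proof -
  assume p: "harmonic_polynomial p"
  then have "lap p = (\<lambda>x. 0)" by (auto simp: harmonic_polynomial_def)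
  with p show ?thesis
    by (auto simp: harmonic_polynomial_def real_polynomial_pd lap_pd pd_const)
qed

lemma sum_inner_Basis:
  fixes i :: "'a::euclidean_space" and c :: "'a \<Rightarrow> real"
  assumes "i \<in> Basis" shows "(\<Sum>j\<in>Basis. (i \<bullet> j) * c j) = c i"
proof -
  have "(\<Sum>j\<in>Basis. (i \<bullet> j) * c j) = (\<Sum>j\<in>Basis. if j = i then c j else 0)"
    by (intro sum.cong refl) (use assms in \<open>auto simp: inner_Basis\<close>)
  then show ?thesis using assms by simp
qed

lemma pd_diff:
  assumes "real_polynomial_function p" "real_polynomial_function q"
  shows "pd (\<lambda>x. p x - q x) i = (\<lambda>x. pd p i x - pd q i x)"
  by (rule ext, rule trans[OF pd_eqI[OF has_derivative_diff[OF assms[THEN real_polynomial_has_derivative]]]])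
     (simp add: pd_def)

lemma harmonic_polynomial_diff:
  "harmonic_polynomial p \<Longrightarrow> harmonic_polynomial q \<Longrightarrow> harmonic_polynomial (\<lambda>x. p x - q x)"
  by (auto simp: harmonic_polynomial_def lap_def pd_diff real_polynomial_pd sum_subtractf)

text \<open>
  Uniform convergence of harmonic polynomials passes to first derivatives on a smaller ball:
  the gradient estimate, applied to differences, turns a uniform Cauchy condition for the
  functions into one for their derivatives.
\<close>

lemma harmonic_limit_derivative:
  fixes v :: "'a::euclidean_space \<Rightarrow> real"
  assumes P: "\<And>k::nat. harmonic_polynomial (P k)" and r: "r > 0"
    and lim: "uniform_limit (ball x r) P v sequentially"
  shows "i \<in> Basis \<Longrightarrow> uniform_limit (ball x (r/2)) (\<lambda>k. pd (P k) i) (pd v i) sequentially"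
    and "y \<in> ball x (r/2) \<Longrightarrow> (v has_derivative (\<lambda>h. \<Sum>i\<in>Basis. (h \<bullet> i) * pd v i y)) (at y)"
proof -
  define K where "K = real (2 * DIM('a) + 12)"
  have K: "K > 0" by (simp add: K_def)
  have pP: "real_polynomial_function (P k)" for k using P by (simp add: harmonic_polynomial_def)
  have conv: "uniformly_convergent_on (ball x (r/2)) (\<lambda>k. pd (P k) i)" if i: "i \<in> Basis" for i
    unfolding uniformly_convergent_eq_Cauchy
  proof (rule uniformly_Cauchy_onI)
    fix e :: real assume e: "e > 0"
    \<comment> \<open>Chosen so that the gradient estimate on balls of radius \<open>r/2\<close> turns \<open>2 * d\<close> into \<open>e / 2\<close>.\<close>
    define d where "d = e * (r/2) / (4 * K)"
    have d: "d > 0" using e r K by (simp add: d_def)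
    from uniform_limitD[OF lim d] obtain N where
      N: "\<And>k y. k \<ge> N \<Longrightarrow> y \<in> ball x r \<Longrightarrow> dist (P k y) (v y) < d"
      unfolding eventually_sequentially by blast
    show "\<exists>M. \<forall>y\<in>ball x (r/2). \<forall>m\<ge>M. \<forall>k\<ge>M. dist (pd (P m) i y) (pd (P k) i y) < e"
    proof (intro exI[of _ N] ballI allI impI)
      fix y m k assume y: "y \<in> ball x (r/2)" and mk: "m \<ge> N" "k \<ge> N"
      define u where "u = (\<lambda>z. P m z - P k z)"
      have "harmonic_polynomial u" unfolding u_def by (intro harmonic_polynomial_diff P)
      then have "\<bar>pd u i y\<bar> \<le> (2 * DIM('a) + 12) * (2 * d) / (r/2)"
      proof (rule gradient_estimate[OF _ _ i, where M="2 * d" and r="r/2"])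
        fix z assume z: "z \<in> cball y (r/2)"
        have "dist x z < r" using dist_triangle[of x z y] y z by simp
        then have "z \<in> ball x r" by simp
        from N[OF mk(1) this] N[OF mk(2) this] show "\<bar>u z\<bar> \<le> 2 * d"
          by (simp add: u_def dist_real_def)
      qed (use r in auto)
      also have "\<dots> = K * (2 * d) / (r/2)" by (simp add: K_def)
      also have "\<dots> = e / 2" using K r by (simp add: d_def field_simps)
      also have "\<dots> < e" using e by simp
      also have "pd u i y = pd (P m) i y - pd (P k) i y"
        by (simp add: u_def pd_diff pP)
      finally show "dist (pd (P m) i y) (pd (P k) i y) < e" by (simp add: dist_real_def)
    qed
  qed
  then have "\<forall>i. \<exists>g. i \<in> Basis \<longrightarrow> uniform_limit (ball x (r/2)) (\<lambda>k. pd (P k) i) g sequentially"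
    unfolding uniformly_convergent_on_def by blast
  then obtain g where
    g: "\<And>i. i \<in> Basis \<Longrightarrow> uniform_limit (ball x (r/2)) (\<lambda>k. pd (P k) i) (g i) sequentially"
    by metis
  let ?D = "\<lambda>y h. \<Sum>i\<in>Basis. (h \<bullet> i) * g i y"
  have frechet: "frechet_derivative (P k) (at y) h = (\<Sum>i\<in>Basis. (h \<bullet> i) * pd (P k) i y)" for k y h
    using has_derivative_linear[OF real_polynomial_has_derivative[OF pP[of k], of y]]
    by (subst euclidean_representation[of h, symmetric]) (simp add: linear_sum linear_cmul pd_def)
  have lim_at: "(\<lambda>k. P k y) \<longlonglongrightarrow> v y" if "y \<in> ball x (r/2)" for y
    using tendsto_uniform_limitI[OF lim, of y] that r by auto
  have "\<exists>w. \<forall>y\<in>ball x (r/2). (\<lambda>k. P k y) \<longlonglongrightarrow> w y \<and> (w has_derivative ?D y) (at y within ball x (r/2))"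
  proof (rule has_derivative_sequence[where f'="\<lambda>k y. frechet_derivative (P k) (at y)" and ?x0.0=x])
    show "(P k has_derivative frechet_derivative (P k) (at y)) (at y within ball x (r/2))" for k y
      by (rule has_derivative_at_withinI[OF real_polynomial_has_derivative[OF pP]])
    fix e :: real assume e: "e > 0"
    then have "e / DIM('a) > 0" by simp
    then have "\<forall>i\<in>Basis. \<forall>\<^sub>F k in sequentially. \<forall>y\<in>ball x (r/2). dist (pd (P k) i y) (g i y) < e / DIM('a)"
      using uniform_limitD[OF g] by blast
    then have "\<forall>\<^sub>F k in sequentially. \<forall>i\<in>Basis. \<forall>y\<in>ball x (r/2). dist (pd (P k) i y) (g i y) < e / DIM('a)"
      by (rule eventually_ball_finite[OF finite_Basis])
    then show "\<forall>\<^sub>F k in sequentially. \<forall>y\<in>ball x (r/2). \<forall>h.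
        norm (frechet_derivative (P k) (at y) h - ?D y h) \<le> e * norm h"
    proof eventually_elim
      case (elim k)
      show ?case
      proof (intro ballI allI)
        fix y h assume y: "y \<in> ball x (r/2)"
        have "norm (frechet_derivative (P k) (at y) h - ?D y h)
            = \<bar>\<Sum>i\<in>Basis. (h \<bullet> i) * (pd (P k) i y - g i y)\<bar>"
          by (simp add: frechet sum_subtractf[symmetric] right_diff_distrib)
        also have "\<dots> \<le> (\<Sum>i\<in>(Basis::'a set). norm h * (e / DIM('a)))"
        proof (rule order_trans[OF sum_abs sum_mono])
          fix i :: 'a assume i: "i \<in> Basis"
          have "\<bar>pd (P k) i y - g i y\<bar> \<le> e / DIM('a)"
            using elim y i by (auto simp: dist_real_def less_imp_le)
          then show "\<bar>(h \<bullet> i) * (pd (P k) i y - g i y)\<bar> \<le> norm h * (e / DIM('a))"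
            unfolding abs_mult using Basis_le_norm[OF i] by (intro mult_mono) auto
        qed
        finally show "norm (frechet_derivative (P k) (at y) h - ?D y h) \<le> e * norm h"
          by (simp add: mult.commute)
      qed
    qed
  next
    show "(\<lambda>k. P k x) \<longlonglongrightarrow> v x" by (rule lim_at) (use r in simp)
  qed (use r in auto)
  then obtain w where w: "\<And>y. y \<in> ball x (r/2) \<Longrightarrow> (\<lambda>k. P k y) \<longlonglongrightarrow> w y"
      "\<And>y. y \<in> ball x (r/2) \<Longrightarrow> (w has_derivative ?D y) (at y within ball x (r/2))" by blast
  have wv: "w y = v y" if "y \<in> ball x (r/2)" for y
    using LIMSEQ_unique[OF w(1)[OF that] lim_at[OF that]] .
  have der: "(v has_derivative ?D y) (at y)" if "y \<in> ball x (r/2)" for y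
  proof (rule has_derivative_transform_within_open[OF _ open_ball that])
    show "(w has_derivative ?D y) (at y)"
      using w(2)[OF that] by (simp add: at_within_open[OF that])
  qed (rule wv)
  have pd_eq: "pd v i y = g i y" if "i \<in> Basis" "y \<in> ball x (r/2)" for i y
    using pd_eqI[OF der[OF that(2)], of i] sum_inner_Basis[OF that(1)] by simp
  show "uniform_limit (ball x (r/2)) (\<lambda>k. pd (P k) i) (pd v i) sequentially" if "i \<in> Basis"
  proof (rule uniform_limitI)
    fix e :: real assume "e > 0"
    from uniform_limitD[OF g[OF that] this]
    show "\<forall>\<^sub>F k in sequentially. \<forall>y\<in>ball x (r/2). dist (pd (P k) i y) (pd v i y) < e"
      by eventually_elim (simp add: pd_eq[OF that])
  qed
  show "(v has_derivative (\<lambda>h. \<Sum>i\<in>Basis. (h \<bullet> i) * pd v i y)) (at y)" if "y \<in> ball x (r/2)"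
    using der[OF that] that by (simp add: pd_eq cong: sum.cong)
qed

lemma harmonic_approx_pd:
  assumes v: "harmonic_approx S v" and i: "i \<in> Basis"
  shows "harmonic_approx S (pd v i)"
  unfolding harmonic_approx_def
proof
  fix x assume "x \<in> S"
  with v obtain r P where r: "r > 0" and P: "\<And>k::nat. harmonic_polynomial (P k)"
    and lim: "uniform_limit (ball x r) P v sequentially"
    unfolding harmonic_approx_def by blast
  show "\<exists>r>0. \<exists>P. (\<forall>k::nat. harmonic_polynomial (P k)) \<and> uniform_limit (ball x r) P (pd v i) sequentially"
    using harmonic_limit_derivative(1)[OF P r lim i] r harmonic_polynomial_pd[OF P]
    by (intro exI[of _ "r/2"] conjI exI[of _ "\<lambda>k. pd (P k) i"]) auto
qed

lemma harmonic_approx_has_derivative: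
  assumes v: "harmonic_approx S v" and x: "x \<in> S"
  shows "(v has_derivative (\<lambda>h. \<Sum>i\<in>Basis. (h \<bullet> i) * pd v i x)) (at x)"
proof -
  from v x obtain r P where r: "r > 0" and P: "\<And>k::nat. harmonic_polynomial (P k)"
    and lim: "uniform_limit (ball x r) P v sequentially"
    unfolding harmonic_approx_def by blast
  from harmonic_limit_derivative(2)[OF P r lim, of x] r show ?thesis by simp
qed

lemma harmonic_approx_continuous_on: "harmonic_approx S v \<Longrightarrow> continuous_on S v"
  by (rule has_derivative_continuous_on) (rule has_derivative_at_withinI, rule harmonic_approx_has_derivative)

lemma harmonic_approx_lap:
  fixes v :: "'a::euclidean_space \<Rightarrow> real"
  assumes v: "harmonic_approx S v" and x: "x \<in> S"
  shows "lap v x = 0"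
proof -
  from v x obtain r P where r: "r > 0" and P: "\<And>k::nat. harmonic_polynomial (P k)"
    and lim: "uniform_limit (ball x r) P v sequentially"
    unfolding harmonic_approx_def by blast
  have "(\<lambda>k. pd (pd (P k) i) i x) \<longlonglongrightarrow> pd (pd v i) i x" if i: "i \<in> Basis" for i
  proof -
    have "uniform_limit (ball x (r/2/2)) (\<lambda>k. pd (pd (P k) i) i) (pd (pd v i) i) sequentially"
      using harmonic_limit_derivative(1)[OF harmonic_polynomial_pd[OF P] _
          harmonic_limit_derivative(1)[OF P r lim i] i] r by simp
    from tendsto_uniform_limitI[OF this, of x] r show ?thesis by simp
  qed
  then have "(\<lambda>k. lap (P k) x) \<longlonglongrightarrow> lap v x"
    unfolding lap_def by (rule tendsto_sum)
  moreover have "lap (P k) x = 0" for k using P by (simp add: harmonic_polynomial_def)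
  ultimately show ?thesis by (simp add: LIMSEQ_const_iff)
qed

lemma harmonic_approx_line_laplacian:
  fixes v :: "'a::euclidean_space \<Rightarrow> real"
  assumes v: "harmonic_approx S v" and S: "open S" and x: "x \<in> S"
  shows "line_laplacian v x 0"
proof -
  have "line_laplacian v x (\<Sum>i\<in>Basis. (\<lambda>i h. \<Sum>j\<in>Basis. (h \<bullet> j) * pd (pd v i) j x) i i)"
  proof (rule line_laplacianI[OF S x, where D="\<lambda>i h. \<Sum>j\<in>Basis. (h \<bullet> j) * pd (pd v i) j x" and v'="\<lambda>y h. \<Sum>i\<in>Basis. (h \<bullet> i) * pd v i y"])
    fix i :: 'a assume i: "i \<in> Basis"
    show "((\<lambda>y. \<Sum>j\<in>Basis. (i \<bullet> j) * pd v j y) has_derivative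
        (\<lambda>h. \<Sum>j\<in>Basis. (h \<bullet> j) * pd (pd v i) j x)) (at x)"
      unfolding sum_inner_Basis[OF i] by (rule harmonic_approx_has_derivative[OF harmonic_approx_pd[OF v i] x])
  qed (rule harmonic_approx_has_derivative[OF v])
  moreover have "(\<Sum>i\<in>Basis. (\<lambda>i h. \<Sum>j\<in>Basis. (h \<bullet> j) * pd (pd v i) j x) i i) = 0"
    using harmonic_approx_lap[OF v x] by (simp add: lap_def sum_inner_Basis)
  ultimately show ?thesis by simp
qed

text \<open>
  Dirichlet's problem on a ball without the Poisson kernel: polynomial boundary values have
  harmonic polynomial solutions, polynomials are dense in the continuous functions on the
  sphere, and by the maximum principle uniform convergence on the sphere spreads to the ball.
\<close>

theorem dirichlet_problem_ball:
  fixes \<phi> :: "'a::euclidean_space \<Rightarrow> real"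
  assumes \<phi>: "continuous_on (sphere c r) \<phi>" and r: "r > 0"
  shows "\<exists>v. continuous_on (cball c r) v \<and> (\<forall>x\<in>sphere c r. v x = \<phi> x) \<and> harmonic_approx (ball c r) v"
proof -
  have "\<exists>Q. harmonic_polynomial Q \<and> (\<forall>x\<in>sphere c r. \<bar>\<phi> x - Q x\<bar> < inverse (Suc k))" for k
  proof -
    have "continuous_on (sphere 0 1) (\<lambda>y. \<phi> (c + r *\<^sub>R y))"
      by (rule continuous_on_compose2[OF \<phi>]) (use r in \<open>auto intro!: continuous_intros simp: dist_norm\<close>)
    then obtain p where p: "real_polynomial_function p"
        "\<And>y. y \<in> sphere 0 1 \<Longrightarrow> \<bar>\<phi> (c + r *\<^sub>R y) - p y\<bar> < inverse (Suc k)"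
      using Stone_Weierstrass_real_polynomial_function[OF compact_sphere, of 0 1 _ "inverse (Suc k)"] by auto
    obtain q where q: "harmonic_polynomial q" "\<And>y. y \<bullet> y = 1 \<Longrightarrow> q y = p y"
      using polynomial_dirichlet_problem[OF p(1)] by blast
    define Q where "Q = (\<lambda>x. q (- (1/r) *\<^sub>R c + (1/r) *\<^sub>R x))"
    have "harmonic_polynomial Q"
      using q(1) real_polynomial_affine[of q "- (1/r) *\<^sub>R c" "1/r"] lap_affine[of q "- (1/r) *\<^sub>R c" "1/r"]
      unfolding Q_def harmonic_polynomial_def by auto
    moreover have "\<bar>\<phi> x - Q x\<bar> < inverse (Suc k)" if "x \<in> sphere c r" for x
    proof -
      define y where "y = - (1/r) *\<^sub>R c + (1/r) *\<^sub>R x"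
      have x: "x = c + r *\<^sub>R y" using r by (simp add: y_def algebra_simps)
      have "norm y = 1" using that r unfolding x by (simp add: dist_norm)
      moreover have "Q x = q y" by (simp add: Q_def y_def)
      ultimately show ?thesis using p(2)[of y] q(2)[of y] x by (simp add: norm_eq_1)
    qed
    ultimately show ?thesis by blast
  qed
  then obtain Q where Q: "\<And>k. harmonic_polynomial (Q k)"
      and near: "\<And>k x. x \<in> sphere c r \<Longrightarrow> \<bar>\<phi> x - Q k x\<bar> < inverse (Suc k)"
    by metis
  have pQ: "real_polynomial_function (Q k)" for k using Q by (simp add: harmonic_polynomial_def)
  have bound: "\<bar>Q m x - Q k x\<bar> \<le> inverse (Suc m) + inverse (Suc k)" if "x \<in> cball c r" for m k x
  proof (rule weakly_harmonic_diff_bound[of "ball c r"])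
    show "line_laplacian (Q k) x 0" for k x
      using real_polynomial_line_laplacian[OF pQ, of k x] Q[of k] by (simp add: harmonic_polynomial_def)
    then show "line_laplacian (Q k) x 0" for k x .
    show "\<bar>Q m y - Q k y\<bar> \<le> inverse (Suc m) + inverse (Suc k)" if "y \<in> closure (ball c r)" "y \<notin> ball c r" for y
      using near[of y m] near[of y k] that r by (auto simp: abs_if split: if_splits)
  qed (use that r in \<open>auto intro: continuous_on_real_polynomial pQ\<close>)
  have "uniformly_convergent_on (cball c r) Q"
    unfolding uniformly_convergent_eq_Cauchy
  proof (rule uniformly_Cauchy_onI)
    fix e :: real assume "e > 0"
    then obtain N where N: "inverse (Suc N) < e / 2"
      using reals_Archimedean[of "e/2"] by auto
    show "\<exists>M. \<forall>x\<in>cball c r. \<forall>m\<ge>M. \<forall>n\<ge>M. dist (Q m x) (Q n x) < e"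
    proof (intro exI[of _ N] ballI allI impI)
      fix x m n assume x: "x \<in> cball c r" and mn: "m \<ge> N" "n \<ge> N"
      have "inverse (real (Suc k)) \<le> inverse (Suc N)" if "k \<ge> N" for k
        using that by (intro le_imp_inverse_le) auto
      from this[OF mn(1)] this[OF mn(2)] bound[OF x, of m n] N
      show "dist (Q m x) (Q n x) < e" unfolding dist_real_def by linarith
    qed
  qed
  then obtain v where v: "uniform_limit (cball c r) Q v sequentially"
    unfolding uniformly_convergent_on_def by blast
  have "continuous_on (cball c r) v"
    by (rule uniform_limit_theorem[OF _ v]) (simp_all add: continuous_on_real_polynomial[OF pQ])
  moreover have "v x = \<phi> x" if x: "x \<in> sphere c r" for x
  proof -
    have "(\<lambda>k. \<phi> x - Q k x) \<longlonglongrightarrow> 0"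
      by (rule Lim_null_comparison[OF _ LIMSEQ_inverse_real_of_nat])
         (use near[OF x] in \<open>auto intro!: always_eventually less_imp_le\<close>)
    moreover have "(\<lambda>k. \<phi> x - Q k x) \<longlonglongrightarrow> \<phi> x - v x"
      using tendsto_uniform_limitI[OF v, of x] x by (intro tendsto_intros) auto
    ultimately show ?thesis using LIMSEQ_unique by force
  qed
  moreover have "harmonic_approx (ball c r) v"
    unfolding harmonic_approx_def
  proof
    fix x assume "x \<in> ball c r"
    then obtain s where s: "s > 0" "ball x s \<subseteq> ball c r" using openE[OF open_ball] by blast
    then have "ball x s \<subseteq> cball c r" by auto
    with s(1) show "\<exists>r>0. \<exists>P. (\<forall>k::nat. harmonic_polynomial (P k)) \<and> uniform_limit (ball x r) P v sequentially"
      using uniform_limit_on_subset[OF v] Q by blast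
  qed
  ultimately show ?thesis by blast
qed

text \<open>
  Comparing with the solution \<open>V\<close> of the Dirichlet problem with the boundary values of the limit:
  \<open>U k - V\<close> is small on the sphere and has a small Laplacian, so a multiple of the squared
  distance from the centre serves as barrier and the limit equals \<open>V\<close>.
\<close>

lemma harmonic_approx_limit:
  fixes v :: "'a::euclidean_space \<Rightarrow> real"
  assumes r: "r > 0" and cont: "\<And>k::nat. continuous_on (cball c r) (U k)"
    and lap: "\<And>k x. x \<in> ball c r \<Longrightarrow> \<exists>L. line_laplacian (U k) x L \<and> \<bar>L\<bar> \<le> \<eta> k"
    and \<eta>: "\<eta> \<longlonglongrightarrow> 0" and lim: "uniform_limit (cball c r) U v sequentially"
  shows "harmonic_approx (ball c r) v"
proof -
  have contv: "continuous_on (cball c r) v"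
    by (rule uniform_limit_theorem[OF _ lim]) (simp_all add: cont)
  obtain V where V: "continuous_on (cball c r) V" "\<And>x. x \<in> sphere c r \<Longrightarrow> V x = v x"
      and hV: "harmonic_approx (ball c r) V"
    using dirichlet_problem_ball[OF continuous_on_subset[OF contv sphere_cball] r] by blast
  have "V x = v x" if x: "x \<in> cball c r" for x
  proof -
    have "\<bar>v x - V x\<bar> \<le> e * (2 + r^2 / 2)" if e: "e > 0" for e
    proof -
      have "\<forall>\<^sub>F k in sequentially. \<eta> k < e \<and> (\<forall>y\<in>cball c r. dist (U k y) (v y) < e)"
        using uniform_limitD[OF lim e] order_tendstoD(2)[OF \<eta> e] by eventually_elim auto
      then obtain k where k: "\<eta> k < e" "\<And>y. y \<in> cball c r \<Longrightarrow> \<bar>U k y - v y\<bar> < e"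
        by (auto simp: eventually_sequentially dist_real_def)
      have "s * (U k x - V x) \<le> e + e * r^2 / 2" if s: "\<bar>s\<bar> = 1" for s
      proof -
        define w where "w = (\<lambda>y. s * (U k y - V y) + e / 2 * ((y - c) \<bullet> (y - c)))"
        have "w x \<le> e + e * r^2 / 2"
        proof (rule maximum_principle[of "ball c r" w "e + e * r^2 / 2" x])
          show "continuous_on (closure (ball c r)) w"
            unfolding w_def using r cont[of k] V(1) by (auto intro!: continuous_intros)
          fix y assume y: "y \<in> ball c r"
          obtain L where L: "line_laplacian (U k) y L" "\<bar>L\<bar> \<le> \<eta> k" using lap[OF y] by blast
          have "line_laplacian w y (s * (L - 0) + e / 2 * (2 * DIM('a)))"
            unfolding w_def
            by (intro line_laplacian_add line_laplacian_cmult line_laplacian_diff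
                line_laplacian_norm_square L harmonic_approx_line_laplacian[OF hV] y) simp
          moreover have "\<bar>s * (L - 0)\<bar> \<le> e" using s L k(1) by (simp add: abs_mult)
          moreover have "e * 1 \<le> e * DIM('a)" using e by (intro mult_left_mono) auto
          ultimately show "\<exists>L\<ge>0. line_laplacian w y L" by (intro exI conjI) auto
        next
          fix y assume "y \<in> closure (ball c r)" "y \<notin> ball c r"
          then have y: "y \<in> sphere c r" "y \<in> cball c r" using r by auto
          have "s * (U k y - V y) \<le> \<bar>s\<bar> * \<bar>U k y - V y\<bar>" by (simp flip: abs_mult)
          also have "\<dots> \<le> e" using s k(2)[OF y(2)] V(2)[OF y(1)] by simp
          moreover have "(y - c) \<bullet> (y - c) = r^2"
            using y by (simp add: power2_norm_eq_inner[symmetric] dist_norm norm_minus_commute)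
          ultimately show "w y \<le> e + e * r^2 / 2" by (simp add: w_def)
        qed (use r x in auto)
        moreover have "0 \<le> e / 2 * ((x - c) \<bullet> (x - c))" using e by simp
        ultimately show ?thesis unfolding w_def by linarith
      qed
      from this[of 1] this[of "-1"] have "\<bar>U k x - V x\<bar> \<le> e + e * r^2 / 2" by (simp add: abs_le_iff)
      with k(2)[OF x] have "\<bar>v x - V x\<bar> \<le> 2 * e + e * r^2 / 2" by linarith
      then show ?thesis by (simp add: algebra_simps)
    qed
    note small = this
    show ?thesis
    proof (rule ccontr)
      assume "V x \<noteq> v x"
      define C where "C = 2 + r^2 / 2"
      have "C > 0" by (simp add: C_def add_pos_nonneg)
      then have "\<bar>v x - V x\<bar> / (2 * C) > 0" using \<open>V x \<noteq> v x\<close> by simp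
      from small[OF this] have "\<bar>v x - V x\<bar> \<le> \<bar>v x - V x\<bar> / 2"
        unfolding C_def[symmetric] using \<open>C > 0\<close> by simp
      with \<open>V x \<noteq> v x\<close> show False by simp
    qed
  qed
  note eq = this
  show ?thesis unfolding harmonic_approx_def
  proof
    fix x assume "x \<in> ball c r"
    then obtain s where s: "s > 0" "ball x s \<subseteq> ball c r" using openE[OF open_ball] by blast
    from hV \<open>x \<in> ball c r\<close> obtain t P where t: "t > 0" "\<forall>k::nat. harmonic_polynomial (P k)"
      "uniform_limit (ball x t) P V sequentially" unfolding harmonic_approx_def by blast
    have "uniform_limit (ball x (min s t)) P V sequentially"
      by (rule uniform_limit_on_subset[OF t(3)]) auto
    moreover have "V y = v y" if "y \<in> ball x (min s t)" for y
      using eq[of y] s(2) that by auto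
    ultimately have "uniform_limit (ball x (min s t)) P v sequentially"
      by (subst uniform_limit_cong'[OF refl, of _ v V]) auto
    with s t show "\<exists>r>0. \<exists>P. (\<forall>k::nat. harmonic_polynomial (P k)) \<and> uniform_limit (ball x r) P v sequentially"
      by (intro exI[of _ "min s t"] exI[of _ P]) auto
  qed
qed

text \<open>
  Apply the preceding lemma to a constant sequence.
\<close>

theorem weakly_harmonic_iff_approx:
  assumes S: "open S"
  shows "weakly_harmonic_on S v \<longleftrightarrow> harmonic_approx S v"
proof
  assume v: "weakly_harmonic_on S v"
  show "harmonic_approx S v" unfolding harmonic_approx_def
  proof
    fix x assume "x \<in> S"
    then obtain r where r: "r > 0" "cball x r \<subseteq> S" using S open_contains_cball by blast
    have "harmonic_approx (ball x r) v"
    proof (rule harmonic_approx_limit[where U="\<lambda>_. v" and \<eta>="\<lambda>_. 0"])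
      show "continuous_on (cball x r) v"
        using v r continuous_on_subset unfolding weakly_harmonic_on_def by blast
      show "\<exists>L. line_laplacian v y L \<and> \<bar>L\<bar> \<le> 0" if "y \<in> ball x r" for y
      proof -
        have "y \<in> S" using that r by auto
        with v show ?thesis unfolding weakly_harmonic_on_def by (intro exI[of _ 0]) auto
      qed
      show "uniform_limit (cball x r) (\<lambda>_. v) v sequentially"
        by (auto intro!: uniform_limitI always_eventually)
    qed (use r in auto)
    then show "\<exists>r>0. \<exists>P. (\<forall>k::nat. harmonic_polynomial (P k)) \<and> uniform_limit (ball x r) P v sequentially"
      using r(1) unfolding harmonic_approx_def by (meson centre_in_ball)
  qed
qed (auto simp: weakly_harmonic_on_def harmonic_approx_continuous_on harmonic_approx_line_laplacian S)

section \<open>Reflection across a hyperplane\<close>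

definition reflect :: "real \<Rightarrow> real \<times> 'b \<Rightarrow> real \<times> 'b" where
  "reflect a p = (2 * a - fst p, snd p)"

lemma reflect_reflect [simp]: "reflect a (reflect a p) = p"
  and fst_reflect [simp]: "fst (reflect a p) = 2 * a - fst p"
  and snd_reflect [simp]: "snd (reflect a p) = snd p"
  by (simp_all add: reflect_def)

lemma continuous_on_reflect [continuous_intros]:
  "continuous_on S (reflect a :: _ \<Rightarrow> real \<times> 'b::topological_space)"
  unfolding reflect_def[abs_def] by (intro continuous_intros)

lemma line_laplacian_reflect:
  fixes u :: "real \<times> 'b::euclidean_space \<Rightarrow> real"
  assumes "line_laplacian u (reflect a x) L"
  shows "line_laplacian (\<lambda>p. u (reflect a p)) x L"
  using line_laplacian_comp[where \<sigma>="reflect a", OF assms, of "\<lambda>i. if fst i = 0 then 1 else -1" 1]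
  by (force simp: Basis_prod_def reflect_def prod_eq_iff)

lemma line_laplacian_translate:
  fixes u :: "'b::euclidean_space \<Rightarrow> real"
  assumes "line_laplacian u (x + c) L"
  shows "line_laplacian (\<lambda>p. u (p + c)) x L"
  using line_laplacian_comp[where \<sigma>="\<lambda>p. p + c", OF assms, of "\<lambda>i. 1" 1]
  by (simp add: algebra_simps)

lemma weakly_harmonic_reflect:
  fixes u :: "real \<times> 'b::euclidean_space \<Rightarrow> real"
  assumes "weakly_harmonic_on UNIV u"
  shows "weakly_harmonic_on UNIV (\<lambda>p. u (reflect a p))"
  using assms unfolding weakly_harmonic_on_def
  by (auto simp del: split_paired_All
      intro!: line_laplacian_reflect continuous_on_compose2[of UNIV u] continuous_intros)

lemma weakly_harmonic_add:
  "weakly_harmonic_on S u \<Longrightarrow> weakly_harmonic_on S v \<Longrightarrow> weakly_harmonic_on S (\<lambda>p. u p + v p)"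
  unfolding weakly_harmonic_on_def using line_laplacian_add by (fastforce intro: continuous_on_add)

lemma weakly_harmonic_diff:
  "weakly_harmonic_on S u \<Longrightarrow> weakly_harmonic_on S v \<Longrightarrow> weakly_harmonic_on S (\<lambda>p. u p - v p)"
  unfolding weakly_harmonic_on_def using line_laplacian_diff by (fastforce intro: continuous_on_diff)

text \<open>
  Only used for functions \<open>w\<close> that vanish on the hyperplane \<open>t = a\<close>, where both branches agree.
\<close>

definition odd_extension :: "real \<Rightarrow> (real \<times> 'b \<Rightarrow> real) \<Rightarrow> real \<times> 'b \<Rightarrow> real" where
  "odd_extension a w p = (if fst p \<le> a then - w (reflect a p) else w p)"

lemma continuous_on_odd_extension:
  fixes w :: "real \<times> 'b::topological_space \<Rightarrow> real"
  assumes w: "continuous_on ({a..b} \<times> UNIV) w" and zero: "\<And>y. w (a, y) = 0"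
  shows "continuous_on ({2*a-b..b} \<times> UNIV) (odd_extension a w)"
  unfolding odd_extension_def[abs_def]
proof (rule continuous_on_cases_le)
  show "continuous_on {p \<in> {2*a-b..b} \<times> UNIV. fst p \<le> a} (\<lambda>p. - w (reflect a p))"
    by (intro continuous_on_minus continuous_on_compose2[OF w] continuous_intros) (auto simp: reflect_def)
  show "continuous_on {p \<in> {2*a-b..b} \<times> UNIV. a \<le> fst p} w"
    by (rule continuous_on_subset[OF w]) auto
  show "- w (reflect a p) = w p" if "fst p = a" for p
    using zero[of "snd p"] that by (cases p) (simp add: reflect_def)
qed (intro continuous_intros)

text \<open>
  The only issue is a point of the hyperplane. There the Dirichlet solution \<open>V\<close> on a small ball
  with the boundary values of the odd extension is itself odd by uniqueness, hence zero on the
  hyperplane; so on each half ball it has the same boundary values as the odd extension and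
  coincides with it.
\<close>

theorem reflection_principle:
  fixes w :: "real \<times> 'b::euclidean_space \<Rightarrow> real"
  assumes ab: "a < b" and w: "continuous_on ({a..b} \<times> UNIV) w"
    and lap: "\<And>p. fst p \<in> {a<..<b} \<Longrightarrow> line_laplacian w p 0" and zero: "\<And>y. w (a, y) = 0"
    and x: "fst x \<in> {2*a-b<..<b}"
  shows "line_laplacian (odd_extension a w) x 0"
proof -
  define W where "W = odd_extension a w"
  have contW: "continuous_on ({2*a-b..b} \<times> UNIV) W"
    unfolding W_def by (rule continuous_on_odd_extension[OF w zero])
  have zero': "w p = 0" if "fst p = a" for p using zero[of "snd p"] that by (cases p) simp
  have odd: "W (reflect a p) = - W p" for p
    by (auto simp: W_def odd_extension_def zero')
  have right: "line_laplacian W x 0" if "fst x \<in> {a<..<b}" for x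
  proof (rule line_laplacian_transform[OF lap[OF that], of "{a<..<b} \<times> UNIV"])
    show "open ({a<..<b} \<times> (UNIV :: 'b set))" by (intro open_Times open_UNIV) simp
  qed (use that in \<open>auto simp: W_def odd_extension_def mem_Times_iff\<close>)
  have left: "line_laplacian W x 0" if "fst x \<in> {2*a-b<..<a}" for x
  proof -
    have "line_laplacian (\<lambda>p. - 1 * W (reflect a p)) x (- 1 * 0)"
      by (intro line_laplacian_cmult line_laplacian_reflect right) (use that in auto)
    then show ?thesis by (simp add: odd)
  qed
  consider "fst x < a" | "fst x > a" | "fst x = a" by linarith
  then have "line_laplacian W x 0"
  proof cases
    case 3
    define r where "r = (b - a) / 2"
    have r: "r > 0" using ab by (simp add: r_def)
    have near: "\<bar>fst p - a\<bar> \<le> dist x p" for p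
      using dist_fst_le[of x p] 3 by (simp add: dist_real_def abs_minus_commute)
    have sub: "cball x r \<subseteq> {2*a-b..b} \<times> UNIV"
    proof
      fix p assume "p \<in> cball x r"
      with near[of p] have "\<bar>fst p - a\<bar> \<le> (b - a) / 2" by (simp add: r_def)
      then show "p \<in> {2*a-b..b} \<times> UNIV" using ab
        unfolding mem_Times_iff abs_le_iff atLeastAtMost_iff by (intro conjI) (linarith | simp)+
    qed
    have reflect_dist: "dist x (reflect a p) = dist x p" for p
      using 3 by (simp add: dist_prod_def dist_real_def abs_minus_commute power2_commute)
    have contWr: "continuous_on (cball x r) W" by (rule continuous_on_subset[OF contW sub])
    obtain V where V: "continuous_on (cball x r) V" "\<And>p. p \<in> sphere x r \<Longrightarrow> V p = W p"
        and hV: "harmonic_approx (ball x r) V"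
      using dirichlet_problem_ball[OF continuous_on_subset[OF contWr sphere_cball] r] by blast
    have lapV: "line_laplacian V p 0" if "p \<in> ball x r" for p
      by (rule harmonic_approx_line_laplacian[OF hV open_ball that])
    have oddV: "V (reflect a p) = - V p" if p: "p \<in> cball x r" for p
    proof -
      have "\<bar>V p - (- 1 * V (reflect a p))\<bar> \<le> 0"
      proof (rule weakly_harmonic_diff_bound[of "ball x r" V "\<lambda>p. - 1 * V (reflect a p)"])
        show "continuous_on (closure (ball x r)) (\<lambda>p. - 1 * V (reflect a p))"
          using r by (auto intro!: continuous_intros continuous_on_compose2[OF V(1)] simp: reflect_dist)
        show "line_laplacian (\<lambda>p. - 1 * V (reflect a p)) q 0" if "q \<in> ball x r" for q
        proof -
          have "line_laplacian (\<lambda>p. - 1 * V (reflect a p)) q (- 1 * 0)"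
            by (intro line_laplacian_cmult line_laplacian_reflect lapV) (use that in \<open>simp add: reflect_dist\<close>)
          then show ?thesis by simp
        qed
        show "\<bar>V q - (- 1 * V (reflect a q))\<bar> \<le> 0" if "q \<in> closure (ball x r)" "q \<notin> ball x r" for q
          using that r V(2)[of q] V(2)[of "reflect a q"] odd[of q] by (simp add: reflect_dist)
      qed (use r V(1) lapV p in auto)
      then show ?thesis by simp
    qed
    define U where "U = ball x r \<inter> {p. fst p > a}"
    have "open {p :: real \<times> 'b. fst p > a}" by (intro open_Collect_less continuous_intros)
    then have U: "open U" "bounded U" unfolding U_def by (auto intro: open_Int bounded_Int)
    have "closed {p :: real \<times> 'b. a \<le> fst p}" by (intro closed_Collect_le continuous_intros)
    then have "closure U \<subseteq> cball x r \<inter> {p. a \<le> fst p}"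
      by (intro closure_minimal closed_Int) (auto simp: U_def)
    then have clU: "closure U \<subseteq> cball x r" "\<And>p. p \<in> closure U \<Longrightarrow> a \<le> fst p" by auto
    have zeroV: "V p = W p" if "p \<in> cball x r" "fst p = a" for p
    proof -
      have "reflect a p = p" using that by (simp add: reflect_def prod_eq_iff)
      then show ?thesis using oddV[OF that(1)] odd[of p] by simp
    qed
    have upper: "V p = W p" if p: "p \<in> U" for p
    proof -
      have "\<bar>V p - W p\<bar> \<le> 0"
      proof (rule weakly_harmonic_diff_bound[OF U])
        show "line_laplacian V q 0" if "q \<in> U" for q using that lapV by (simp add: U_def)
        show "line_laplacian W q 0" if "q \<in> U" for q
          using that near[of q] by (intro right) (auto simp: U_def r_def field_simps)
        show "\<bar>V q - W q\<bar> \<le> 0" if "q \<in> closure U" "q \<notin> U" for q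
        proof (cases "fst q = a")
          case True
          with zeroV[of q] clU(1) that show ?thesis by auto
        next
          case False
          with that clU have "q \<in> sphere x r" by (fastforce simp: U_def)
          with V(2) show ?thesis by simp
        qed
      qed (use p closure_subset[of U] continuous_on_subset[OF V(1) clU(1)]
              continuous_on_subset[OF contWr clU(1)] in auto)
      then show ?thesis by simp
    qed
    have eq: "V p = W p" if p: "p \<in> ball x r" for p
    proof -
      consider "fst p > a" | "fst p = a" | "fst p < a" by linarith
      then show ?thesis
      proof cases
        case 3
        have "V (reflect a p) = W (reflect a p)"
          by (rule upper) (use 3 p in \<open>simp add: U_def reflect_dist\<close>)
        with odd[of p] oddV[of p] p show ?thesis by simp
      qed (use p upper[of p] zeroV[of p] in \<open>auto simp: U_def\<close>)
    qed
    show ?thesis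
      by (rule line_laplacian_transform[OF lapV open_ball[of x r]]) (use r eq in auto)
  qed (use left right x in auto)
  then show ?thesis by (simp add: W_def)
qed

section \<open>Iterated reflection of the slab solution\<close>

text \<open>
  A slab solution whose two boundary values are restrictions of globally harmonic functions.
  Reflection preserves this kind of data, which is what makes the iteration possible.
\<close>

definition slab_solution :: "real \<Rightarrow> real \<Rightarrow> (real \<times> 'b::euclidean_space \<Rightarrow> real) \<Rightarrow> bool" where
  "slab_solution a b H \<longleftrightarrow> a < b \<and> continuous_on ({a..b} \<times> UNIV) H \<and>
     (\<forall>p. fst p \<in> {a<..<b} \<longrightarrow> line_laplacian H p 0) \<and>
     (\<exists>u. weakly_harmonic_on UNIV u \<and> (\<forall>y. u (a, y) = H (a, y))) \<and>
     (\<exists>v. weakly_harmonic_on UNIV v \<and> (\<forall>y. v (b, y) = H (b, y)))"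

text \<open>
  If \<open>u\<close> and \<open>v\<close> are the global functions carrying the data at \<open>a\<close> and \<open>b\<close>, the odd extension of
  \<open>H - u\<close> plus \<open>u\<close> extends \<open>H\<close>, and at the new boundary \<open>t = 2a - b\<close> it equals
  \<open>u(t, y) + u(2a - t, y) - v(2a - t, y)\<close>, again the restriction of a global harmonic function.
\<close>

lemma slab_solution_extend_left:
  assumes H: "slab_solution a b H"
  shows "\<exists>H'. slab_solution (2*a-b) b H' \<and> (\<forall>p. fst p \<in> {a..b} \<longrightarrow> H' p = H p)"
proof -
  from H have ab: "a < b" and cont: "continuous_on ({a..b} \<times> UNIV) H"
    and lap: "\<And>p. fst p \<in> {a<..<b} \<Longrightarrow> line_laplacian H p 0" by (auto simp: slab_solution_def)
  from H obtain u v where u: "weakly_harmonic_on UNIV u" "\<And>y. u (a, y) = H (a, y)"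
    and v: "weakly_harmonic_on UNIV v" "\<And>y. v (b, y) = H (b, y)" by (auto simp: slab_solution_def)
  have contu: "continuous_on UNIV u" and lapu: "\<And>p. line_laplacian u p 0"
    using u(1) by (auto simp: weakly_harmonic_on_def)
  define w where "w = (\<lambda>p. H p - u p)"
  define H' where "H' = (\<lambda>p. u p + odd_extension a w p)"
  have w: "continuous_on ({a..b} \<times> UNIV) w"
    unfolding w_def by (intro continuous_on_diff cont continuous_on_subset[OF contu]) auto
  have zero: "w (a, y) = 0" for y by (simp add: w_def u(2))
  have lapw: "line_laplacian w p 0" if "fst p \<in> {a<..<b}" for p
    using line_laplacian_diff[OF lap[OF that] lapu[of p]] by (simp add: w_def)
  have eq: "H' p = H p" if "fst p \<in> {a..b}" for p
  proof (cases "fst p = a")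
    case True
    then have "reflect a p = (a, snd p)" "p = (a, snd p)" by (simp_all add: reflect_def prod_eq_iff)
    then show ?thesis using zero[of "snd p"] u(2)[of "snd p"] by (metis H'_def add.right_neutral odd_extension_def minus_zero)
  qed (use that in \<open>simp add: H'_def odd_extension_def w_def\<close>)
  have "slab_solution (2*a-b) b H'"
    unfolding slab_solution_def
  proof (intro conjI allI impI)
    show "continuous_on ({2*a-b..b} \<times> UNIV) H'"
      unfolding H'_def
      by (intro continuous_on_add continuous_on_subset[OF contu] continuous_on_odd_extension[OF w zero]) auto
    show "line_laplacian H' p 0" if "fst p \<in> {2*a-b<..<b}" for p
      using line_laplacian_add[OF lapu[of p] reflection_principle[OF ab w lapw zero that]] by (simp add: H'_def)
    show "\<exists>u. weakly_harmonic_on UNIV u \<and> (\<forall>y. u (2*a-b, y) = H' (2*a-b, y))"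
      using ab
      by (intro exI[of _ "\<lambda>p. u p + u (reflect a p) - v (reflect a p)"] conjI
          weakly_harmonic_add weakly_harmonic_diff weakly_harmonic_reflect u v)
        (auto simp: H'_def odd_extension_def w_def reflect_def v(2))
    show "\<exists>v. weakly_harmonic_on UNIV v \<and> (\<forall>y. v (b, y) = H' (b, y))"
      using v eq ab by (intro exI[of _ v]) auto
  qed (use ab in simp)
  with eq show ?thesis by blast
qed

text \<open>The mirror image in \<open>t = 0\<close> reduces the extension to the right to the one to the left.\<close>

lemma slab_solution_mirror:
  assumes "slab_solution a b H"
  shows "slab_solution (-b) (-a) (\<lambda>p. H (reflect 0 p))"
proof -
  from assms obtain u v where u: "weakly_harmonic_on UNIV u" "\<And>y. u (a, y) = H (a, y)"
    and v: "weakly_harmonic_on UNIV v" "\<And>y. v (b, y) = H (b, y)" by (auto simp: slab_solution_def)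
  from assms show ?thesis unfolding slab_solution_def
  proof (intro conjI)
    assume *: "a < b \<and> continuous_on ({a..b} \<times> UNIV) H \<and>
      (\<forall>p. fst p \<in> {a<..<b} \<longrightarrow> line_laplacian H p 0) \<and>
      (\<exists>u. weakly_harmonic_on UNIV u \<and> (\<forall>y. u (a, y) = H (a, y))) \<and>
      (\<exists>v. weakly_harmonic_on UNIV v \<and> (\<forall>y. v (b, y) = H (b, y)))"
    show "continuous_on ({-b..-a} \<times> UNIV) (\<lambda>p. H (reflect 0 p))"
      by (rule continuous_on_compose2[of "{a..b} \<times> UNIV" H])
         (use * in \<open>auto intro!: continuous_intros simp: reflect_def\<close>)
    show "\<forall>p. fst p \<in> {-b<..<-a} \<longrightarrow> line_laplacian (\<lambda>p. H (reflect 0 p)) p 0"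
      using * by (auto simp del: split_paired_All intro!: line_laplacian_reflect)
    show "\<exists>u. weakly_harmonic_on UNIV u \<and> (\<forall>y. u (- b, y) = H (reflect 0 (- b, y)))"
      using v by (intro exI[of _ "\<lambda>p. v (reflect 0 p)"] conjI weakly_harmonic_reflect) (auto simp: reflect_def)
    show "\<exists>v. weakly_harmonic_on UNIV v \<and> (\<forall>y. v (- a, y) = H (reflect 0 (- a, y)))"
      using u by (intro exI[of _ "\<lambda>p. u (reflect 0 p)"] conjI weakly_harmonic_reflect) (auto simp: reflect_def)
  qed simp
qed

lemma slab_solution_extend:
  assumes H: "slab_solution a b H"
  shows "\<exists>H'. slab_solution (2*a-b) (3*b-2*a) H' \<and> (\<forall>p. fst p \<in> {a..b} \<longrightarrow> H' p = H p)"
proof -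
  obtain H1 where H1: "slab_solution (2*a-b) b H1" "\<And>p. fst p \<in> {a..b} \<Longrightarrow> H1 p = H p"
    using slab_solution_extend_left[OF H] by blast
  obtain H2 where H2: "slab_solution (2*(-b)-(-(2*a-b))) (-(2*a-b)) H2"
      "\<And>p. fst p \<in> {-b..-(2*a-b)} \<Longrightarrow> H2 p = H1 (reflect 0 p)"
    using slab_solution_extend_left[OF slab_solution_mirror[OF H1(1)]] by blast
  have "slab_solution (2*a-b) (3*b-2*a) (\<lambda>p. H2 (reflect 0 p))"
    using slab_solution_mirror[OF H2(1)] by (simp add: algebra_simps)
  moreover have "H2 (reflect 0 p) = H p" if "fst p \<in> {a..b}" for p
    using H2(2)[of "reflect 0 p"] H1(2)[OF that] that by auto
  ultimately show ?thesis by blast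
qed

text \<open>
  Every extension step adds at least the original width \<open>\<delta>\<close> on each side, so the slabs exhaust the
  space. The successive extensions agree where both are defined, hence glue together.
\<close>

theorem slab_solution_extends_globally:
  fixes H :: "real \<times> 'b::euclidean_space \<Rightarrow> real"
  assumes H: "slab_solution a b H"
  shows "\<exists>h. weakly_harmonic_on UNIV h \<and> (\<forall>p. fst p \<in> {a<..<b} \<longrightarrow> h p = H p)"
proof -
  define \<delta> where "\<delta> = b - a"
  have \<delta>: "\<delta> > 0" using H by (simp add: \<delta>_def slab_solution_def)
  define good where "good = (\<lambda>n (\<alpha>, \<beta>, G :: real \<times> 'b \<Rightarrow> real).
    slab_solution \<alpha> \<beta> G \<and> \<alpha> \<le> a - real n * \<delta> \<and> \<beta> \<ge> b + real n * \<delta> \<and> (n = 0 \<longrightarrow> \<alpha> = a \<and> \<beta> = b \<and> G = H))"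
  define ext where "ext = (\<lambda>(n::nat) (\<alpha>, \<beta>, G :: real \<times> 'b \<Rightarrow> real) (\<alpha>', \<beta>', G').
    \<alpha>' \<le> (\<alpha>::real) \<and> (\<beta>::real) \<le> \<beta>' \<and> (\<forall>p. fst p \<in> {\<alpha>..\<beta>} \<longrightarrow> G' p = G p))"
  have "\<exists>f. \<forall>n. good n (f n) \<and> ext n (f n) (f (Suc n))"
  proof (rule dependent_nat_choice)
    show "\<exists>s. good 0 s" using H by (intro exI[of _ "(a, b, H)"]) (simp add: good_def)
    fix s n assume s: "good n s"
    obtain \<alpha> \<beta> G where [simp]: "s = (\<alpha>, \<beta>, G)" by (cases s)
    from s have G: "slab_solution \<alpha> \<beta> G" and le: "\<alpha> \<le> a - real n * \<delta>" "\<beta> \<ge> b + real n * \<delta>"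
      by (auto simp: good_def)
    have "0 \<le> real n * \<delta>" using \<delta> by simp
    with le have wide: "\<beta> - \<alpha> \<ge> \<delta>" by (simp add: \<delta>_def)
    obtain G' where "slab_solution (2*\<alpha>-\<beta>) (3*\<beta>-2*\<alpha>) G'" "\<And>p. fst p \<in> {\<alpha>..\<beta>} \<Longrightarrow> G' p = G p"
      using slab_solution_extend[OF G] by blast
    then show "\<exists>s'. good (Suc n) s' \<and> ext n s s'"
      using le wide \<delta>
      by (intro exI[of _ "(2*\<alpha>-\<beta>, 3*\<beta>-2*\<alpha>, G')"]) (auto simp: good_def ext_def algebra_simps)
  qed
  then obtain f where f: "\<And>n. good n (f n)" "\<And>n. ext n (f n) (f (Suc n))" by blast
  define A where "A = (\<lambda>n. fst (f n))"
  define B where "B = (\<lambda>n. fst (snd (f n)))"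
  define G where "G = (\<lambda>n. snd (snd (f n)))"
  have fn: "f n = (A n, B n, G n)" for n by (simp add: A_def B_def G_def)
  have G: "slab_solution (A n) (B n) (G n)" "A n \<le> a - real n * \<delta>" "B n \<ge> b + real n * \<delta>"
    and init: "A 0 = a" "B 0 = b" "G 0 = H" for n
    using f(1)[of n] f(1)[of 0] by (auto simp: good_def fn)
  have ext: "A (Suc n) \<le> A n" "B n \<le> B (Suc n)" "\<forall>p. fst p \<in> {A n..B n} \<longrightarrow> G (Suc n) p = G n p" for n
    using f(2)[of n] by (auto simp: ext_def fn)
  have mono: "A n \<le> A m \<and> B m \<le> B n \<and> (\<forall>p. fst p \<in> {A m..B m} \<longrightarrow> G n p = G m p)" if "m \<le> n" for m n
    using that
  proof (induction rule: dec_induct)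
    case (step n)
    then show ?case using ext[of n] by force
  qed simp
  have agree: "G n p = G m p" if "fst p \<in> {A m..B m}" "fst p \<in> {A n..B n}" for m n p
    using mono[of m n] mono[of n m] that by (metis nat_le_linear)
  have cover: "\<exists>n. fst p \<in> {A n<..<B n}" for p :: "real \<times> 'b"
  proof -
    obtain n where "\<bar>fst p\<bar> + \<bar>a\<bar> + \<bar>b\<bar> < real n * \<delta>" using reals_Archimedean3[OF \<delta>] by blast
    with G(2,3)[of n] show ?thesis by (intro exI[of _ n]) auto
  qed
  define h where "h = (\<lambda>p. G (SOME n. fst p \<in> {A n<..<B n}) p)"
  have hG: "h p = G n p" if "fst p \<in> {A n<..<B n}" for n p
  proof -
    have "fst p \<in> {A (SOME n. fst p \<in> {A n<..<B n})<..<B (SOME n. fst p \<in> {A n<..<B n})}"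
      using someI_ex[OF cover[of p]] .
    then show ?thesis unfolding h_def using that by (intro agree) auto
  qed
  have opn: "open ({s<..<t} \<times> (UNIV :: 'b set))" for s t :: real by (intro open_Times open_UNIV) simp
  have "weakly_harmonic_on UNIV h"
    unfolding weakly_harmonic_on_def
  proof (intro conjI ballI)
    show "continuous_on UNIV h"
      unfolding continuous_on_eq_continuous_at[OF open_UNIV]
    proof
      fix p :: "real \<times> 'b"
      obtain n where n: "fst p \<in> {A n<..<B n}" using cover by blast
      have "continuous_on ({A n<..<B n} \<times> UNIV) (G n)"
        using G(1)[of n] by (auto simp: slab_solution_def elim!: continuous_on_subset)
      then have "continuous_on ({A n<..<B n} \<times> UNIV) h"
        by (subst continuous_on_cong[OF refl hG[of _ n]]) auto
      then show "continuous (at p) h" 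
        using n by (cases p) (simp add: continuous_on_eq_continuous_at[OF opn])
    qed
    fix p :: "real \<times> 'b"
    obtain n where n: "fst p \<in> {A n<..<B n}" using cover by blast
    then have "line_laplacian (G n) p 0" using G(1)[of n] by (simp add: slab_solution_def del: split_paired_All)
    then show "line_laplacian h p 0"
      by (rule line_laplacian_transform[OF _ opn[of "A n" "B n"]]) (use n hG in \<open>auto simp: mem_Times_iff\<close>)
  qed
  moreover have "h p = H p" if "fst p \<in> {a<..<b}" for p
    using hG[of p 0] that by (simp add: init)
  ultimately show ?thesis by blast
qed

section \<open>Entire functions of several variables\<close>

text \<open>Complex partial derivatives, and the holomorphic extension of the Laplacian on \<open>\<real>\<^sup>n\<close>.\<close>

definition cpd :: "'n::finite \<Rightarrow> (complex ^ 'n \<Rightarrow> complex) \<Rightarrow> complex ^ 'n \<Rightarrow> complex" where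
  "cpd j F z = frechet_derivative F (at z) (axis j 1)"

definition complex_lap :: "(complex ^ 'n::finite \<Rightarrow> complex) \<Rightarrow> complex ^ 'n \<Rightarrow> complex" where
  "complex_lap F z = (\<Sum>j\<in>UNIV. cpd j (cpd j F) z)"

lemma holomorphic_has_derivative:
  assumes "holomorphic_everywhere F"
  shows "(F has_derivative (\<lambda>v. \<Sum>j\<in>UNIV. v $ j * cpd j F z)) (at z)"
proof -
  from assms obtain D where D: "(F has_derivative D) (at z)" "\<And>c v. D (c *s v) = c * D v"
    unfolding holomorphic_everywhere_def by blast
  have "D v = (\<Sum>j\<in>UNIV. v $ j * cpd j F z)" for v
  proof -
    have "D v = D (\<Sum>j\<in>UNIV. v $ j *s axis j 1)" by (simp add: basis_expansion)
    also have "\<dots> = (\<Sum>j\<in>UNIV. v $ j * D (axis j 1))"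
      using has_derivative_linear[OF D(1)] by (simp add: linear_sum D(2))
    finally show ?thesis using frechet_derivative_at[OF D(1)] by (simp add: cpd_def)
  qed
  with D(1) show ?thesis by (metis (no_types, lifting) ext)
qed

lemma holomorphic_everywhereI:
  assumes "\<And>z. (F has_derivative (\<lambda>v. \<Sum>j\<in>UNIV. v $ j * c j z)) (at z)"
  shows "holomorphic_everywhere F"
  unfolding holomorphic_everywhere_def
proof
  fix z
  show "\<exists>D. (F has_derivative D) (at z) \<and> (\<forall>c v. D (c *s v) = c * D v)"
    by (intro exI conjI, rule assms) (simp add: sum_distrib_left mult.assoc)
qed

lemma holomorphic_everywhere_sum:
  assumes "\<And>i. i \<in> I \<Longrightarrow> holomorphic_everywhere (F i)"
  shows "holomorphic_everywhere (\<lambda>z. \<Sum>i\<in>I. F i z)"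
proof (rule holomorphic_everywhereI)
  fix z
  have "((\<lambda>z. \<Sum>i\<in>I. F i z) has_derivative (\<lambda>v. \<Sum>i\<in>I. \<Sum>j\<in>UNIV. v $ j * cpd j (F i) z)) (at z)"
    by (intro has_derivative_sum holomorphic_has_derivative assms)
  then show "((\<lambda>z. \<Sum>i\<in>I. F i z) has_derivative (\<lambda>v. \<Sum>j\<in>UNIV. v $ j * (\<Sum>i\<in>I. cpd j (F i) z))) (at z)"
    by (subst (asm) sum.swap) (simp add: sum_distrib_left)
qed

lemma continuous_on_holomorphic: "holomorphic_everywhere F \<Longrightarrow> continuous_on S F"
  by (rule has_derivative_continuous_on) (rule has_derivative_at_withinI, rule holomorphic_has_derivative)

lemma bounded_linear_axis: "bounded_linear (axis j :: complex \<Rightarrow> complex ^ 'n::finite)"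
  unfolding linear_conv_bounded_linear[symmetric]
  by (rule linearI) (auto simp: vec_eq_iff axis_def)

lemma axis_zero: "axis j (0::complex) = 0"
  by (simp add: vec_eq_iff axis_def)

lemma slice_has_field_derivative:
  assumes "holomorphic_everywhere F"
  shows "((\<lambda>\<zeta>. F (z + axis j \<zeta>)) has_field_derivative cpd j F (z + axis j \<zeta>)) (at \<zeta>)"
proof -
  have "((\<lambda>\<zeta>. F (z + axis j \<zeta>)) has_derivative
      (\<lambda>h. \<Sum>k\<in>UNIV. axis j h $ k * cpd k F (z + axis j \<zeta>))) (at \<zeta>)"
    by (rule has_derivative_compose[where f="\<lambda>\<zeta>. z + axis j \<zeta>", OF _ holomorphic_has_derivative[OF assms]])
       (auto intro!: derivative_eq_intros bounded_linear.has_derivative[OF bounded_linear_axis])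
  moreover have "(\<Sum>k\<in>UNIV. axis j h $ k * cpd k F (z + axis j \<zeta>)) = cpd j F (z + axis j \<zeta>) * h" for h
    by (simp add: axis_def if_distrib if_distribR cong: if_cong)
  ultimately show ?thesis by (simp add: has_field_derivative_def)
qed

lemma slice_holomorphic:
  "holomorphic_everywhere F \<Longrightarrow> (\<lambda>\<zeta>. F (z + axis j \<zeta>)) holomorphic_on S"
  by (rule holomorphic_onI) (use slice_has_field_derivative field_differentiable_at_within field_differentiable_def in blast)

lemma cpd_cauchy_bound:
  assumes F: "holomorphic_everywhere F" and r: "r > 0"
    and bd: "\<And>\<zeta>. norm \<zeta> = r \<Longrightarrow> norm (F (z + axis j \<zeta>)) \<le> B"
  shows "norm (cpd j F z) \<le> B / r"
proof -
  have "norm ((deriv ^^ 1) (\<lambda>\<zeta>. F (z + axis j \<zeta>)) 0) \<le> fact 1 * B / r ^ 1"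
    by (rule Cauchy_inequality[OF slice_holomorphic[OF F] holomorphic_on_imp_continuous_on[OF slice_holomorphic[OF F]] r])
       (use bd in auto)
  then show ?thesis
    using DERIV_imp_deriv[OF slice_has_field_derivative[OF F, of z j 0]] by (simp add: axis_zero)
qed

lemma cpd_integral:
  assumes F: "holomorphic_everywhere F"
  shows "cpd j F z = integral (cbox 0 1) (\<lambda>t. F (z + axis j (cis (2 * pi * t))) * cis (- 2 * pi * t))"
proof -
  let ?f = "\<lambda>\<zeta>. F (z + axis j \<zeta>)"
  have hol: "?f holomorphic_on S" for S by (rule slice_holomorphic[OF F])
  have "(?f has_field_derivative (1 / (2 * of_real pi * \<i>) *
      contour_integral (circlepath 0 1) (\<lambda>u. ?f u / (u - 0)^2))) (at 0)"
    by (rule Cauchy_derivative_integral_circlepath(2)[OF holomorphic_on_imp_continuous_on[OF hol] hol]) simp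
  then have "cpd j F z = 1 / (2 * of_real pi * \<i>) * contour_integral (circlepath 0 1) (\<lambda>u. ?f u / u^2)"
    using DERIV_unique[OF slice_has_field_derivative[OF F, of z j 0]] by (simp add: axis_zero)
  also have "contour_integral (circlepath 0 1) (\<lambda>u. ?f u / u^2) =
      integral {0..1} (\<lambda>t. (2 * of_real pi * \<i>) * (?f (cis (2 * pi * t)) * cis (- 2 * pi * t)))"
    unfolding contour_integral_integral
  proof (rule integral_cong)
    fix t :: real
    have "exp (2 * of_real pi * \<i> * of_real t) = cis (2 * pi * t)" by (simp add: cis_conv_exp mult_ac)
    moreover have "cis (- 2 * pi * t) = inverse (cis (2 * pi * t))" by (simp add: cis_inverse)
    ultimately show "?f (circlepath 0 1 t) / (circlepath 0 1 t)\<^sup>2 * vector_derivative (circlepath 0 1) (at t)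
        = (2 * of_real pi * \<i>) * (?f (cis (2 * pi * t)) * cis (- 2 * pi * t))"
      unfolding vector_derivative_circlepath by (simp add: circlepath power2_eq_square field_simps)
  qed
  finally show ?thesis by (simp add: cbox_interval)
qed

lemma continuous_on_cpd:
  assumes F: "holomorphic_everywhere F"
  shows "continuous_on S (cpd j F)"
proof -
  have "continuous_on (S \<times> cbox 0 1)
      (\<lambda>(z, t). F (z + axis j (cis (2 * pi * t))) * cis (- 2 * pi * t))"
    unfolding case_prod_unfold
    by (intro continuous_intros continuous_on_compose2[OF continuous_on_holomorphic[OF F, of UNIV]]
        bounded_linear.continuous_on[OF bounded_linear_axis]) (auto intro!: continuous_intros)
  from integral_continuous_on_param[OF this] show ?thesis
    by (simp add: cpd_integral[OF F])
qed

text \<open>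
  The Cauchy integral exhibits a partial derivative as an average of translates of \<open>F\<close>, so it can
  be differentiated under the integral sign: the first derivatives are continuous by the same
  formula.
\<close>

lemma holomorphic_cpd:
  fixes F :: "complex ^ 'n::finite \<Rightarrow> complex"
  assumes F: "holomorphic_everywhere F"
  shows "holomorphic_everywhere (cpd j F)"
proof -
  define \<gamma> where "\<gamma> = (\<lambda>t::real. axis j (cis (2 * pi * t)) :: complex ^ 'n)"
  define f where "f = (\<lambda>z t. F (z + \<gamma> t) * cis (- 2 * pi * t))"
  define fx where "fx = (\<lambda>z t. Blinfun (\<lambda>v::complex ^ 'n. (\<Sum>k\<in>UNIV. v $ k * cpd k F (z + \<gamma> t)) * cis (- 2 * pi * t)))"
  have \<gamma>: "continuous_on S \<gamma>" for S
    unfolding \<gamma>_def by (intro bounded_linear.continuous_on[OF bounded_linear_axis] continuous_intros)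
  have "bounded_linear (\<lambda>v::complex ^ 'n. (\<Sum>k\<in>UNIV. v $ k * cpd k F (z + \<gamma> t)) * cis (- 2 * pi * t))" for z t
    by (intro bounded_linear_intros bounded_linear_vec_nth)
  then have fx: "blinfun_apply (fx z t) = (\<lambda>v. (\<Sum>k\<in>UNIV. v $ k * cpd k F (z + \<gamma> t)) * cis (- 2 * pi * t))" for z t
    unfolding fx_def by (rule bounded_linear_Blinfun_apply)
  have der: "((\<lambda>z. f z t) has_derivative blinfun_apply (fx z t)) (at z)" for z t
    unfolding fx f_def
    by (intro has_derivative_mult_left
        has_derivative_compose[where f="\<lambda>z. z + \<gamma> t", OF _ holomorphic_has_derivative[OF F]])
       (auto intro!: derivative_eq_intros)
  have contF: "continuous_on S (\<lambda>p. G (fst p + \<gamma> (snd p)))"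
    if "continuous_on UNIV G" for S and G :: "complex ^ 'n \<Rightarrow> complex"
    by (rule continuous_on_compose2[OF that])
       (auto intro!: continuous_intros continuous_on_compose2[OF \<gamma>[of UNIV]])
  have int: "f z integrable_on cbox 0 1" for z
    unfolding f_def
    by (intro integrable_continuous continuous_intros continuous_on_compose2[OF continuous_on_holomorphic[OF F, of UNIV]])
       (auto intro!: continuous_intros \<gamma>)
  have cont: "continuous_on (UNIV \<times> cbox 0 1) (\<lambda>(z, t). fx z t)"
    unfolding case_prod_unfold
    by (rule continuous_on_blinfun_componentwise)
       (auto simp: fx intro!: continuous_intros contF continuous_on_cpd[OF F])
  have eq: "cpd j F = (\<lambda>z. integral (cbox 0 1) (f z))"
    unfolding f_def \<gamma>_def by (rule ext, rule cpd_integral[OF F])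
  show ?thesis
  proof (rule holomorphic_everywhereI)
    fix z
    let ?I = "integral (cbox 0 1) (fx z)"
    have der_I: "((\<lambda>z. integral (cbox 0 1) (f z)) has_derivative blinfun_apply ?I) (at z within UNIV)"
      by (rule leibniz_rule[where U=UNIV and fx=fx]) (use der int cont in auto)
    have fxint: "fx z integrable_on cbox 0 1"
      using continuous_on_compose2[OF cont continuous_on_Pair[OF continuous_on_const continuous_on_id], of z "cbox 0 1"]
      by (intro integrable_continuous) auto
    have apply_I: "blinfun_apply ?I v = integral (cbox 0 1) (\<lambda>t. blinfun_apply (fx z t) v)" for v
      using integral_linear[OF fxint bounded_bilinear.bounded_linear_left[OF bounded_bilinear_blinfun_apply], of v] by (simp add: o_def)
    have I_expand: "blinfun_apply ?I v = (\<Sum>k\<in>UNIV. v $ k * blinfun_apply ?I (axis k 1))" for v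
    proof -
      have "blinfun_apply ?I v = blinfun_apply ?I (\<Sum>k\<in>UNIV. v $ k *s axis k 1)" by (simp add: basis_expansion)
      also have "\<dots> = (\<Sum>k\<in>UNIV. blinfun_apply ?I (v $ k *s axis k 1))" by (simp add: blinfun.sum_right)
      also have "\<dots> = (\<Sum>k\<in>UNIV. v $ k * blinfun_apply ?I (axis k 1))"
      proof (rule sum.cong[OF refl])
        fix k
        have "blinfun_apply (fx z t) (v $ k *s axis k 1) = v $ k * blinfun_apply (fx z t) (axis k 1)" for t
          by (simp add: fx sum_distrib_left mult.assoc)
        then show "blinfun_apply ?I (v $ k *s axis k 1) = v $ k * blinfun_apply ?I (axis k 1)"
          unfolding apply_I by simp
      qed
      finally show ?thesis .
    qed
    have "blinfun_apply ?I = (\<lambda>v. \<Sum>k\<in>UNIV. v $ k * blinfun_apply ?I (axis k 1))"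
      using I_expand by (rule ext)
    with der_I show "(cpd j F has_derivative
        (\<lambda>v. \<Sum>k\<in>UNIV. v $ k * (\<lambda>k z. blinfun_apply (integral (cbox 0 1) (fx z)) (axis k 1)) k z)) (at z)"
      unfolding eq by metis
  qed
qed

lemma holomorphic_complex_lap:
  "holomorphic_everywhere F \<Longrightarrow> holomorphic_everywhere (complex_lap F)"
  unfolding complex_lap_def[abs_def] by (intro holomorphic_everywhere_sum holomorphic_cpd)

lemma holomorphic_complex_lap_iter:
  "holomorphic_everywhere F \<Longrightarrow> holomorphic_everywhere ((complex_lap ^^ k) F)"
  by (induction k) (auto intro: holomorphic_complex_lap)

definition polydisc :: "real \<Rightarrow> (complex ^ 'n::finite) set" where
  "polydisc \<rho> = {z. \<forall>j. norm (z $ j) \<le> \<rho>}"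

lemma holomorphic_bounded_on_polydisc:
  assumes "holomorphic_everywhere (F :: complex ^ 'n::finite \<Rightarrow> complex)"
  shows "\<exists>M\<ge>0. \<forall>z\<in>polydisc \<rho>. norm (F z) \<le> M"
proof -
  have "compact (F ` cball 0 (CARD('n) * \<rho>))"
    by (intro compact_continuous_image continuous_on_holomorphic assms compact_cball)
  then obtain M where M: "M > 0" "\<And>z. z \<in> cball 0 (CARD('n) * \<rho>) \<Longrightarrow> norm (F z) \<le> M"
    using compact_imp_bounded bounded_pos by (metis imageI)
  have "z \<in> cball 0 (CARD('n) * \<rho>)" if "z \<in> polydisc \<rho>" for z :: "complex ^ 'n"
  proof -
    have "norm z \<le> (\<Sum>j\<in>UNIV. norm (z $ j))" unfolding norm_vec_def by (rule L2_set_le_sum) simp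
    also have "\<dots> \<le> (\<Sum>j\<in>(UNIV::'n set). \<rho>)" using that by (intro sum_mono) (simp add: polydisc_def)
    finally show ?thesis by simp
  qed
  with M show ?thesis by (intro exI[of _ M]) auto
qed

text \<open>
  Two applications of Cauchy's estimate per coordinate, each on a polydisc smaller by \<open>\<delta>\<close>.
\<close>

lemma complex_lap_bound:
  fixes F :: "complex ^ 'n::finite \<Rightarrow> complex"
  assumes F: "holomorphic_everywhere F" and \<delta>: "\<delta> > 0"
    and M: "\<And>z. z \<in> polydisc (\<rho> + 2 * \<delta>) \<Longrightarrow> norm (F z) \<le> M" and z: "z \<in> polydisc \<rho>"
  shows "norm (complex_lap F z) \<le> CARD('n) / \<delta>^2 * M"
proof -
  have step: "norm (cpd j G w) \<le> B / \<delta>"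
    if "holomorphic_everywhere G" "\<And>z. z \<in> polydisc (s + \<delta>) \<Longrightarrow> norm (G z) \<le> B" "w \<in> polydisc s" for G B s w j
  proof (rule cpd_cauchy_bound[OF that(1) \<delta>])
    fix \<zeta> :: complex assume \<zeta>: "norm \<zeta> = \<delta>"
    have "norm ((w + axis j \<zeta>) $ k) \<le> s + \<delta>" for k
      using that(3) \<zeta> \<delta> by (auto simp: polydisc_def axis_def intro: norm_triangle_mono order_trans)
    then show "norm (G (w + axis j \<zeta>)) \<le> B" by (intro that(2)) (simp add: polydisc_def)
  qed
  have "norm (cpd j (cpd j F) z) \<le> M / \<delta> / \<delta>" for j
  proof (rule step[OF holomorphic_cpd[OF F] _ z])
    show "norm (cpd j F w) \<le> M / \<delta>" if "w \<in> polydisc (\<rho> + \<delta>)" for w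
      by (rule step[OF F _ that]) (use M in \<open>simp add: add.assoc\<close>)
  qed
  then have "norm (complex_lap F z) \<le> (\<Sum>j\<in>(UNIV::'n set). M / \<delta> / \<delta>)"
    unfolding complex_lap_def by (intro sum_norm_le) auto
  then show ?thesis by (simp add: power2_eq_square)
qed

lemma complex_lap_iter_bound:
  fixes F :: "complex ^ 'n::finite \<Rightarrow> complex"
  assumes F: "holomorphic_everywhere F" and \<delta>: "\<delta> > 0"
    and M: "\<And>z. z \<in> polydisc (\<rho> + 2 * k * \<delta>) \<Longrightarrow> norm (F z) \<le> M" and z: "z \<in> polydisc \<rho>"
  shows "norm ((complex_lap ^^ k) F z) \<le> (CARD('n) / \<delta>^2) ^ k * M"
  using M z
proof (induction k arbitrary: \<rho> z)
  case (Suc k)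
  have "norm (complex_lap ((complex_lap ^^ k) F) z) \<le> CARD('n) / \<delta>^2 * ((CARD('n) / \<delta>^2) ^ k * M)"
  proof (rule complex_lap_bound[OF holomorphic_complex_lap_iter[OF F] \<delta> _ Suc.prems(2)])
    show "norm ((complex_lap ^^ k) F w) \<le> (CARD('n) / \<delta>^2) ^ k * M" if "w \<in> polydisc (\<rho> + 2 * \<delta>)" for w
      by (rule Suc.IH[OF _ that], rule Suc.prems) (simp add: algebra_simps)
  qed
  then show ?case by (simp add: mult.assoc)
qed simp

text \<open>The left-hand side divided by \<open>m!\<close> is one term of the series of \<open>exp m\<close>.\<close>

lemma power_le_exp_fact: "real m ^ m \<le> exp (real m) * fact m"
proof -
  have "(\<Sum>n\<in>{m}. real m ^ n /\<^sub>R fact n) \<le> (\<Sum>n. real m ^ n /\<^sub>R fact n)"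
    by (rule sum_le_suminf[OF sums_summable[OF exp_converges]]) auto
  then have "real m ^ m / fact m \<le> exp (real m)"
    using sums_unique[OF exp_converges[of "real m"]] by (simp add: divide_inverse mult.commute)
  then show ?thesis by (simp add: field_simps)
qed

text \<open>
  Cauchy's estimate, used \<open>2k\<close> times with steps \<open>\<delta> = R / (2k)\<close>, costs \<open>(2k)\<^sup>2\<^sup>k / R\<^sup>2\<^sup>k\<close>, and
  \<open>(2k)\<^sup>2\<^sup>k \<le> e\<^sup>2\<^sup>k (2k)!\<close>. As \<open>F\<close> is entire, \<open>R\<close> may be chosen large compared with \<open>T\<close>.
\<close>

lemma complex_lap_series_bound:
  fixes F :: "complex ^ 'n::finite \<Rightarrow> complex" and T :: real
  assumes F: "holomorphic_everywhere F" and T: "T > 0"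
  shows "\<exists>M. \<forall>k (t::real) z. \<bar>t\<bar> \<le> T \<longrightarrow> z \<in> polydisc \<rho> \<longrightarrow>
    norm (t ^ (2*k) / fact (2*k)) * norm ((complex_lap ^^ k) F z) \<le> M * (1/4) ^ k"
proof -
  define n where "n = real CARD('n)"
  have n: "n \<ge> 1" by (simp add: n_def Suc_leI)
  \<comment> \<open>With this choice the ratio \<open>n (e T / R)\<^sup>2\<close> of the majorant is \<open>1 / (4n)\<close>.\<close>
  define R where "R = 2 * exp 1 * T * n"
  have R: "R > 0" using T n by (simp add: R_def)
  obtain M where M: "M \<ge> 0" "\<And>z. z \<in> polydisc (\<rho> + R) \<Longrightarrow> norm (F z) \<le> M"
    using holomorphic_bounded_on_polydisc[OF F] by blast
  have "norm (t ^ (2*k) / fact (2*k)) * norm ((complex_lap ^^ k) F z) \<le> M * (1/4) ^ k"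
    if t: "\<bar>t\<bar> \<le> T" and z: "z \<in> polydisc \<rho>" for k z and t :: real
  proof (cases "k = 0")
    case True
    have "z \<in> polydisc (\<rho> + R)" using z R by (auto simp: polydisc_def intro!: add_increasing2)
    with M True show ?thesis by simp
  next
    case False
    define \<delta> where "\<delta> = R / (2 * k)"
    have \<delta>: "\<delta> > 0" "2 * k * \<delta> = R" using False R by (simp_all add: \<delta>_def)
    have "norm (t ^ (2*k) / fact (2*k)) \<le> T ^ (2*k) / fact (2*k)"
      using t by (simp add: power_abs divide_right_mono power_mono)
    moreover have "norm ((complex_lap ^^ k) F z) \<le> (n / \<delta>^2) ^ k * M"
      unfolding n_def by (rule complex_lap_iter_bound[OF F \<delta>(1) _ z]) (use M(2) \<delta>(2) in simp)
    ultimately have "norm (t ^ (2*k) / fact (2*k)) * norm ((complex_lap ^^ k) F z)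
        \<le> T ^ (2*k) / fact (2*k) * ((n / \<delta>^2) ^ k * M)"
      by (intro mult_mono) (use T in auto)
    also have "(n / \<delta>^2) ^ k = n ^ k / R ^ (2*k) * real (2*k) ^ (2*k)"
    proof -
      have "n / \<delta>^2 = n / R^2 * real (2*k) ^ 2" by (simp add: \<delta>_def power_divide)
      then show ?thesis by (simp only: power_mult_distrib power_divide power_mult)
    qed
    also have "T ^ (2*k) / fact (2*k) * (n ^ k / R ^ (2*k) * real (2*k) ^ (2*k) * M)
        \<le> T ^ (2*k) / fact (2*k) * (n ^ k / R ^ (2*k) * (exp (real (2*k)) * fact (2*k)) * M)"
      using n R T M(1) by (intro mult_left_mono mult_right_mono power_le_exp_fact) auto
    also have "\<dots> = M * (n * (exp 1 * T / R)^2) ^ k"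
    proof -
      have "exp (real (2*k)) = exp 1 ^ (2*k)" by (simp add: exp_of_nat_mult[symmetric])
      then show ?thesis by (simp add: power_mult_distrib power_divide power_mult[symmetric])
    qed
    also have "\<dots> \<le> M * (1/4) ^ k"
    proof (intro mult_left_mono power_mono M(1))
      have "exp 1 * T / R = 1 / (2 * n)" unfolding R_def using T n by simp
      then have "n * (exp 1 * T / R)^2 = n * (1 / (2 * n))^2" by (simp only:)
      also have "\<dots> = 1 / (4 * n)" using n by (simp add: power2_eq_square field_simps)
      also have "\<dots> \<le> 1/4" using n by (simp add: field_simps)
      finally show "n * (exp 1 * T / R)^2 \<le> 1/4" .
    qed (use n in auto)
    finally show ?thesis .
  qed
  then show ?thesis by blast
qed

section \<open>Harmonic extension of entire data\<close>

lemma sum_Basis_prod: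
  fixes f :: "real \<times> 'b::euclidean_space \<Rightarrow> real"
  shows "(\<Sum>i\<in>Basis. f i) = f (1, 0) + (\<Sum>i\<in>Basis. f (0, i))"
proof -
  have "(Basis :: (real \<times> 'b) set) = insert (1, 0) ((\<lambda>i. (0, i)) ` Basis)"
    by (auto simp: Basis_prod_def)
  moreover have "(1, 0) \<notin> (\<lambda>i. (0 :: real, i :: 'b)) ` Basis" by auto
  ultimately have "(\<Sum>i\<in>Basis. f i) = f (1, 0) + sum f ((\<lambda>i. (0, i)) ` Basis)"
    by (metis finite_Basis finite_imageI sum.insert)
  then show ?thesis by (simp add: sum.reindex inj_on_def)
qed

lemma line_laplacian_separated:
  fixes g :: "'b::euclidean_space \<Rightarrow> real"
  assumes c: "\<And>s. (c has_real_derivative c1 s) (at s)" "(c1 has_real_derivative c2) (at t)"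
    and g: "line_laplacian g y L"
  shows "line_laplacian (\<lambda>p. c (fst p) * g (snd p)) (t, y) (c2 * g y + c t * L)"
proof -
  from g obtain g1 d where g:
    "\<And>i. i\<in>Basis \<Longrightarrow> \<forall>\<^sub>F s in nhds 0. ((\<lambda>s. g (y + s *\<^sub>R i)) has_real_derivative g1 i s) (at s)"
    "\<And>i. i\<in>Basis \<Longrightarrow> (g1 i has_real_derivative d i) (at 0)" "L = (\<Sum>i\<in>Basis. d i)"
    unfolding line_laplacian_def by blast
  define w1 where "w1 = (\<lambda>i::real \<times> 'b. if fst i = 0 then (\<lambda>s. c t * g1 (snd i) s) else (\<lambda>s. c1 (t + s) * g y))"
  define w2 where "w2 = (\<lambda>i::real \<times> 'b. if fst i = 0 then c t * d (snd i) else c2 * g y)"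
  have shift: "((\<lambda>s. h (t + s)) has_real_derivative h') (at s)"
    if "(h has_real_derivative h') (at (t + s))" for h h' s
    using that DERIV_shift[of h h' s t] by (simp add: add.commute)
  show ?thesis
    unfolding line_laplacian_def
  proof (intro exI[of _ w1] exI[of _ w2] conjI ballI)
    fix i :: "real \<times> 'b" assume "i \<in> Basis"
    then consider "i = (1, 0)" | j where "i = (0, j)" "j \<in> Basis" by (auto simp: Basis_prod_def)
    then have "(\<forall>\<^sub>F s in nhds 0. ((\<lambda>s. c (fst ((t, y) + s *\<^sub>R i)) * g (snd ((t, y) + s *\<^sub>R i)))
        has_real_derivative w1 i s) (at s)) \<and> (w1 i has_real_derivative w2 i) (at 0)"
    proof cases
      case 1
      have "(c1 has_real_derivative c2) (at (t + 0))" using c(2) by simp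
      with 1 show ?thesis
        by (auto simp: w1_def w2_def intro!: always_eventually DERIV_cmult_right shift c(1))
    next
      case 2
      then show ?thesis
        using g(1,2)[OF 2(2)] by (auto simp: w1_def w2_def intro!: DERIV_cmult elim!: eventually_mono)
    qed
    then show "\<forall>\<^sub>F s in nhds 0. ((\<lambda>s. c (fst ((t, y) + s *\<^sub>R i)) * g (snd ((t, y) + s *\<^sub>R i)))
        has_real_derivative w1 i s) (at s)" and "(w1 i has_real_derivative w2 i) (at 0)" by auto
  next
    show "c2 * g y + c t * L = (\<Sum>i\<in>Basis. w2 i)"
      by (simp add: sum_Basis_prod w2_def g(3) sum_distrib_left)
  qed
qed

text \<open>
  \<open>\<Lambda>\<close> will be the real or the imaginary part.
\<close>

lemma line_laplacian_restrict_to_reals: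
  fixes F :: "complex ^ 'n::finite \<Rightarrow> complex"
  assumes F: "holomorphic_everywhere F" and \<Lambda>: "bounded_linear \<Lambda>"
  shows "line_laplacian (\<lambda>y. \<Lambda> (F (complex_vec y))) y (\<Lambda> (complex_lap F (complex_vec y)))"
proof -
  have cv: "bounded_linear (complex_vec :: real ^ 'n \<Rightarrow> complex ^ 'n)"
    unfolding linear_conv_bounded_linear[symmetric]
    by (rule linearI) (auto simp: vec_eq_iff complex_vec_def scaleR_conv_of_real[symmetric])
  have der: "((\<lambda>y. \<Lambda> (G (complex_vec y))) has_derivative
      (\<lambda>h. \<Lambda> (\<Sum>j\<in>UNIV. of_real (h $ j) * cpd j G (complex_vec y)))) (at y)"
    if "holomorphic_everywhere G" for G and y :: "real ^ 'n"
    using has_derivative_compose[OF bounded_linear_imp_has_derivative[OF cv] holomorphic_has_derivative[OF that], of y]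
    by (intro bounded_linear.has_derivative[OF \<Lambda>]) (simp add: complex_vec_def)
  have axis: "(\<Sum>j\<in>UNIV. of_real (axis k (1::real) $ j) * c j) = c k" for k :: 'n and c :: "'n \<Rightarrow> complex"
    by (simp add: axis_def if_distrib if_distribR cong: if_cong)
  have Basis: "(Basis :: (real ^ 'n) set) = range (\<lambda>k. axis k 1)"
    by (auto simp: Basis_vec_def)
  have "line_laplacian (\<lambda>y. \<Lambda> (F (complex_vec y))) y
    (\<Sum>i\<in>Basis. (\<lambda>i h. \<Lambda> (\<Sum>j\<in>UNIV. of_real (h $ j) * cpd j (\<lambda>z. \<Sum>k\<in>UNIV. of_real (i $ k) * cpd k F z) (complex_vec y))) i i)"
  proof (rule line_laplacianI[where S=UNIV
        and D="\<lambda>i h. \<Lambda> (\<Sum>j\<in>UNIV. of_real (h $ j) * cpd j (\<lambda>z. \<Sum>k\<in>UNIV. of_real (i $ k) * cpd k F z) (complex_vec y))"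
        and v'="\<lambda>y h. \<Lambda> (\<Sum>j\<in>UNIV. of_real (h $ j) * cpd j F (complex_vec y))"])
    fix i :: "real ^ 'n" assume "i \<in> Basis"
    then obtain k where k: "i = axis k 1" by (auto simp: Basis)
    show "((\<lambda>y. \<Lambda> (\<Sum>j\<in>UNIV. of_real (i $ j) * cpd j F (complex_vec y))) has_derivative
      (\<lambda>h. \<Lambda> (\<Sum>j\<in>UNIV. of_real (h $ j) * cpd j (\<lambda>z. \<Sum>k\<in>UNIV. of_real (i $ k) * cpd k F z) (complex_vec y)))) (at y)"
      unfolding k axis by (rule der[OF holomorphic_cpd[OF F]])
  qed (use der[OF F] in auto)
  also have "(\<Sum>i\<in>Basis. (\<lambda>i h. \<Lambda> (\<Sum>j\<in>UNIV. of_real (h $ j) * cpd j (\<lambda>z. \<Sum>k\<in>UNIV. of_real (i $ k) * cpd k F z) (complex_vec y))) i i)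
      = (\<Sum>k\<in>UNIV. \<Lambda> (cpd k (cpd k F) (complex_vec y)))"
    unfolding Basis by (subst sum.reindex) (auto simp: inj_on_def axis_eq_axis axis)
  also have "\<dots> = \<Lambda> (complex_lap F (complex_vec y))"
    using bounded_linear.linear[OF \<Lambda>] by (simp add: complex_lap_def linear_sum)
  finally show ?thesis .
qed

text \<open>
  The Cauchy--Kovalevskaya series \<open>\<Sum>k. (-1)\<^sup>k t\<^sup>2\<^sup>k / (2k)! lap\<^sup>k f\<close>. The Laplacian of its
  partial sums telescopes to the last term, with \<open>f\<close> replaced by \<open>lap f\<close>; it tends to \<open>0\<close> by the same
  estimate that makes the series converge, so the limit is harmonic without any
  differentiation of the series.
\<close>

theorem entire_data_harmonic_extension:
  fixes F :: "complex ^ 'n::finite \<Rightarrow> complex" and \<Lambda> :: "complex \<Rightarrow> real"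
  assumes F: "holomorphic_everywhere F" and \<Lambda>: "bounded_linear \<Lambda>" and \<Lambda>_le: "\<And>z. \<bar>\<Lambda> z\<bar> \<le> norm z"
  shows "\<exists>u :: real \<times> (real ^ 'n) \<Rightarrow> real. weakly_harmonic_on UNIV u \<and> (\<forall>y. u (0, y) = \<Lambda> (F (complex_vec y)))"
proof -
  define c where "c = (\<lambda>k t::real. (-1) ^ k * (t ^ (2*k) / fact (2*k)))"
  define g where "g = (\<lambda>k y. \<Lambda> ((complex_lap ^^ k) F (complex_vec y)))"
  define f where "f = (\<lambda>k (p :: real \<times> (real ^ 'n)). c k (fst p) * g k (snd p))"
  define u where "u = (\<lambda>p. \<Sum>k. f k p)"
  have lapg: "line_laplacian (g k) y (g (Suc k) y)" for k y
    using line_laplacian_restrict_to_reals[OF holomorphic_complex_lap_iter[OF F] \<Lambda>, of k y] by (simp add: g_def)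
  have power_fact: "((\<lambda>t::real. t ^ Suc m / fact (Suc m)) has_real_derivative t ^ m / fact m) (at t)" for m t
  proof -
    have "((\<lambda>t::real. t ^ Suc m / fact (Suc m)) has_real_derivative real (Suc m) * t ^ m / fact (Suc m)) (at t)"
      using DERIV_cdivide[OF DERIV_pow[of "Suc m" t UNIV], of "fact (Suc m)"] by (simp del: fact_Suc of_nat_Suc)
    moreover have "real (Suc m) * t ^ m / fact (Suc m) = t ^ m / fact m"
      unfolding fact_Suc of_nat_id by (simp del: of_nat_Suc)
    ultimately show ?thesis by simp
  qed
  have c_Suc: "(c (Suc k) has_real_derivative - ((-1) ^ k * (t ^ (2*k+1) / fact (2*k+1)))) (at t)" for k t
    unfolding c_def using DERIV_cmult[OF power_fact[of "2*k+1" t], of "(-1) ^ Suc k"] by simp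
  have c_Suc2: "((\<lambda>t. - ((-1) ^ k * (t ^ (2*k+1) / fact (2*k+1)))) has_real_derivative - c k t) (at t)" for k t
    unfolding c_def using DERIV_cmult[OF power_fact[of "2*k" t], of "- ((-1) ^ k)"] by simp
  have lap0: "line_laplacian (f 0) p (c 0 (fst p) * g 1 (snd p))" for p
    using line_laplacian_separated[of "c 0" "\<lambda>_. 0" 0 "fst p" "g 0" "snd p", OF _ _ lapg]
    by (simp add: f_def c_def)
  have lapS: "line_laplacian (f (Suc k)) p (- c k (fst p) * g (Suc k) (snd p) + c (Suc k) (fst p) * g (Suc (Suc k)) (snd p))" for k p
    using line_laplacian_separated[OF c_Suc[of k] c_Suc2[of k "fst p"] lapg[of "Suc k" "snd p"]] by (simp add: f_def)
  \<comment> \<open>The Laplacian telescopes, since the second derivative of \<open>c (Suc k)\<close> is \<open>- c k\<close>.\<close>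
  have lapU: "line_laplacian (\<lambda>p. \<Sum>k<Suc N. f k p) p (c N (fst p) * g (Suc N) (snd p))" for N p
  proof (induction N)
    case (Suc N)
    show ?case using line_laplacian_add[OF Suc lapS[of N p]] by simp
  qed (use lap0 in simp)
  have contf: "continuous_on S (f k)" for S k
    unfolding f_def c_def g_def
    by (intro continuous_intros bounded_linear.continuous_on[OF \<Lambda>]
        continuous_on_compose2[OF continuous_on_holomorphic[OF holomorphic_complex_lap_iter[OF F], of UNIV]])
       (auto simp: complex_vec_def intro!: continuous_intros)
  have "harmonic_approx (ball 0 r) u" if r: "r > 0" for r
  proof -
    have in_disc: "\<bar>fst p\<bar> \<le> r" "complex_vec (snd p) \<in> polydisc r" if "p \<in> cball 0 r" for p :: "real \<times> (real ^ 'n)"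
    proof -
      have "norm (fst p) \<le> r" "norm (snd p) \<le> r"
        using that norm_fst_le[of "fst p" "snd p"] norm_snd_le[of "snd p" "fst p"] by auto
      then show "\<bar>fst p\<bar> \<le> r" "complex_vec (snd p) \<in> polydisc r"
        by (auto simp: polydisc_def complex_vec_def intro: order_trans[OF component_le_norm_cart])
    qed
    obtain M where M: "\<And>k t z. \<bar>t\<bar> \<le> r \<Longrightarrow> z \<in> polydisc r \<Longrightarrow>
        norm (t ^ (2*k) / fact (2*k)) * norm ((complex_lap ^^ k) F z) \<le> M * (1/4) ^ k"
      using complex_lap_series_bound[OF F r, of r] by blast
    obtain M' where M': "\<And>k t z. \<bar>t\<bar> \<le> r \<Longrightarrow> z \<in> polydisc r \<Longrightarrow>
        norm (t ^ (2*k) / fact (2*k)) * norm ((complex_lap ^^ k) (complex_lap F) z) \<le> M' * (1/4) ^ k"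
      using complex_lap_series_bound[OF holomorphic_complex_lap[OF F] r, of r] by blast
    have term_le: "\<bar>c k t * \<Lambda> z\<bar> \<le> norm (t ^ (2*k) / fact (2*k)) * norm z" for k t z
    proof -
      have "\<bar>c k t\<bar> = norm (t ^ (2*k) / fact (2*k))" by (simp add: c_def abs_mult power_abs)
      then show ?thesis unfolding abs_mult by (metis mult_left_mono \<Lambda>_le norm_ge_zero)
    qed
    have "norm (f k p) \<le> M * (1/4) ^ k" if "p \<in> cball 0 r" for k p
    proof -
      have "norm (f k p) \<le> norm (fst p ^ (2*k) / fact (2*k)) * norm ((complex_lap ^^ k) F (complex_vec (snd p)))"
        using term_le by (simp add: f_def g_def)
      also have "\<dots> \<le> M * (1/4) ^ k" by (rule M[OF in_disc[OF that]])
      finally show ?thesis .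
    qed
    then have "uniform_limit (cball 0 r) (\<lambda>N p. \<Sum>k<N. f k p) u sequentially"
      unfolding u_def by (rule Weierstrass_m_test) (auto intro!: summable_mult summable_geometric)
    then have lim: "uniform_limit (cball 0 r) (\<lambda>N p. \<Sum>k<Suc N. f k p) u sequentially"
      by (rule filterlim_compose[OF _ filterlim_Suc])
    have small: "\<exists>L. line_laplacian (\<lambda>p. \<Sum>k<Suc N. f k p) p L \<and> \<bar>L\<bar> \<le> M' * (1/4) ^ N"
      if p: "p \<in> ball 0 r" for N and p :: "real \<times> (real ^ 'n)"
    proof -
      have "\<bar>c N (fst p) * g (Suc N) (snd p)\<bar>
          \<le> norm (fst p ^ (2*N) / fact (2*N)) * norm ((complex_lap ^^ N) (complex_lap F) (complex_vec (snd p)))"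
        unfolding g_def funpow_Suc_right o_apply by (rule term_le)
      also have "\<dots> \<le> M' * (1/4) ^ N" using p by (intro M' in_disc) auto
      finally show ?thesis using lapU by blast
    qed
    have null: "(\<lambda>N. M' * (1/4) ^ N) \<longlonglongrightarrow> 0"
      by (auto intro!: tendsto_mult_right_zero LIMSEQ_power_zero)
    show ?thesis
      by (rule harmonic_approx_limit[OF r continuous_on_sum[OF contf] small null lim])
  qed
  then have "harmonic_approx UNIV u"
    unfolding harmonic_approx_def
    by (metis UNIV_I add_strict_increasing2 mem_ball_0 norm_ge_zero zero_less_one less_add_one)
  then have "weakly_harmonic_on UNIV u" by (simp add: weakly_harmonic_iff_approx)
  moreover have "u (0, y) = \<Lambda> (F (complex_vec y))" for y
  proof -
    have "f k (0, y) = 0" if "k \<notin> {0}" for k using that by (simp add: f_def c_def)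
    then have "u (0, y) = (\<Sum>k\<in>{0}. f k (0, y))" unfolding u_def by (intro suminf_finite) auto
    then show ?thesis by (simp add: f_def c_def g_def)
  qed
  ultimately show ?thesis by blast
qed

section \<open>From weak to classical harmonicity\<close>

lemma harmonic_on_imp_line_laplacian:
  assumes f: "harmonic_on S f" and x: "x \<in> S" and \<Lambda>: "bounded_linear \<Lambda>"
  shows "line_laplacian (\<lambda>x. \<Lambda> (f x)) x 0"
proof -
  have S: "open S" and f1: "\<And>y. y \<in> S \<Longrightarrow> f differentiable (at y)"
    and f2: "\<And>i. i \<in> Basis \<Longrightarrow> partial_deriv f i differentiable (at x)" and lap: "laplacian f x = 0"
    using f x by (auto simp: harmonic_on_def C2_on_def)
  have "line_laplacian (\<lambda>x. \<Lambda> (f x)) x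
    (\<Sum>i\<in>Basis. (\<lambda>i h. \<Lambda> (frechet_derivative (partial_deriv f i) (at x) h)) i i)"
  proof (rule line_laplacianI[OF S x, where D="\<lambda>i h. \<Lambda> (frechet_derivative (partial_deriv f i) (at x) h)" and v'="\<lambda>y h. \<Lambda> (frechet_derivative f (at y) h)"])
    show "((\<lambda>x. \<Lambda> (f x)) has_derivative (\<lambda>h. \<Lambda> (frechet_derivative f (at y) h))) (at y)" if "y \<in> S" for y
      using f1[OF that] by (intro bounded_linear.has_derivative[OF \<Lambda>]) (simp add: frechet_derivative_works)
    show "((\<lambda>y. \<Lambda> (frechet_derivative f (at y) i)) has_derivative
        (\<lambda>h. \<Lambda> (frechet_derivative (partial_deriv f i) (at x) h))) (at x)" if "i \<in> Basis" for i
      using f2[OF that] bounded_linear.has_derivative[OF \<Lambda>]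
      by (simp add: frechet_derivative_works partial_deriv_def[abs_def])
  qed
  also have "(\<Sum>i\<in>Basis. (\<lambda>i h. \<Lambda> (frechet_derivative (partial_deriv f i) (at x) h)) i i) = \<Lambda> (laplacian f x)"
    using bounded_linear.linear[OF \<Lambda>] by (simp add: laplacian_def partial_deriv_def linear_sum)
  also have "\<dots> = 0" using bounded_linear.linear[OF \<Lambda>] by (simp add: lap linear_0)
  finally show ?thesis .
qed

lemma Complex_has_derivative:
  assumes "harmonic_approx UNIV u" "harmonic_approx UNIV v"
  shows "((\<lambda>x. Complex (u x) (v x)) has_derivative
    (\<lambda>h. \<Sum>i\<in>Basis. of_real (h \<bullet> i) * Complex (pd u i x) (pd v i x))) (at x)"
proof -
  have "((\<lambda>x. of_real (u x) + \<i> * of_real (v x)) has_derivative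
    (\<lambda>h. of_real (\<Sum>i\<in>Basis. (h \<bullet> i) * pd u i x) + \<i> * of_real (\<Sum>i\<in>Basis. (h \<bullet> i) * pd v i x))) (at x)"
    by (intro has_derivative_add has_derivative_mult_right has_derivative_of_real
        harmonic_approx_has_derivative[OF _ UNIV_I] assms)
  then show ?thesis
    by (simp add: Complex_eq sum.distrib sum_distrib_left algebra_simps)
qed

lemma partial_deriv_Complex:
  assumes "harmonic_approx UNIV u" "harmonic_approx UNIV v" "j \<in> Basis"
  shows "partial_deriv (\<lambda>x. Complex (u x) (v x)) j = (\<lambda>x. Complex (pd u j x) (pd v j x))"
proof
  fix x
  have "partial_deriv (\<lambda>x. Complex (u x) (v x)) j x
      = (\<Sum>i\<in>Basis. of_real (j \<bullet> i) * Complex (pd u i x) (pd v i x))"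
    using frechet_derivative_at[OF Complex_has_derivative[OF assms(1,2), of x], symmetric]
    by (simp add: partial_deriv_def)
  also have "\<dots> = (\<Sum>i\<in>Basis. if i = j then Complex (pd u i x) (pd v i x) else 0)"
    by (intro sum.cong refl) (use assms(3) in \<open>auto simp: inner_Basis\<close>)
  finally show "partial_deriv (\<lambda>x. Complex (u x) (v x)) j x = Complex (pd u j x) (pd v j x)"
    using assms(3) by simp
qed

lemma weakly_harmonic_imp_harmonic_on:
  assumes "weakly_harmonic_on UNIV u" "weakly_harmonic_on UNIV v"
  shows "harmonic_on UNIV (\<lambda>x. Complex (u x) (v x))"
proof -
  have uv: "harmonic_approx UNIV u" "harmonic_approx UNIV v"
    using assms by (simp_all add: weakly_harmonic_iff_approx)
  note pd_uv = harmonic_approx_pd[OF uv(1)] harmonic_approx_pd[OF uv(2)]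
  have diff: "(\<lambda>x. Complex (u x) (v x)) differentiable (at x)"
    if "harmonic_approx UNIV u" "harmonic_approx UNIV v" for u v :: "'a \<Rightarrow> real" and x
    using Complex_has_derivative[OF that] differentiable_def by blast
  have pd2: "partial_deriv (partial_deriv (\<lambda>x. Complex (u x) (v x)) i) j
      = (\<lambda>x. Complex (pd (pd u i) j x) (pd (pd v i) j x))" if "i \<in> Basis" "j \<in> Basis" for i j
    using that by (simp add: partial_deriv_Complex uv pd_uv)
  show ?thesis
    unfolding harmonic_on_def C2_on_def
  proof (intro conjI ballI)
    show "partial_deriv (\<lambda>x. Complex (u x) (v x)) i differentiable (at x)" if "i \<in> Basis" for i x
      using diff[OF pd_uv(1)[OF that] pd_uv(2)[OF that]] by (simp add: partial_deriv_Complex uv that)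
    show "continuous_on UNIV (partial_deriv (partial_deriv (\<lambda>x. Complex (u x) (v x)) i) j)"
      if "i \<in> Basis" "j \<in> Basis" for i j
      unfolding pd2[OF that] unfolding Complex_eq
      by (intro continuous_intros harmonic_approx_continuous_on harmonic_approx_pd uv that)
    show "laplacian (\<lambda>x. Complex (u x) (v x)) x = 0" for x
    proof -
      have "laplacian (\<lambda>x. Complex (u x) (v x)) x = Complex (lap u x) (lap v x)"
      proof -
        have "laplacian (\<lambda>x. Complex (u x) (v x)) x
            = (\<Sum>i\<in>Basis. Complex (pd (pd u i) i x) (pd (pd v i) i x))"
          by (simp add: laplacian_def pd2)
        then show ?thesis by (simp add: lap_def Complex_eq sum.distrib sum_distrib_left)
      qed
      then show ?thesis
        using harmonic_approx_lap[OF uv(1), of x] harmonic_approx_lap[OF uv(2), of x] by (simp add: Complex_eq)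
    qed
  qed (auto intro: diff uv)
qed

lemma entire_data_on_hyperplane:
  fixes f :: "real ^ 'n::finite \<Rightarrow> complex" and \<Lambda> :: "complex \<Rightarrow> real"
  assumes f: "entire f" and \<Lambda>: "bounded_linear \<Lambda>" and \<Lambda>_le: "\<And>z. \<bar>\<Lambda> z\<bar> \<le> norm z"
  shows "\<exists>u :: real \<times> (real ^ 'n) \<Rightarrow> real. weakly_harmonic_on UNIV u \<and> (\<forall>y. u (a, y) = \<Lambda> (f y))"
proof -
  obtain F where F: "holomorphic_everywhere F" "\<And>y. F (complex_vec y) = f y"
    using f by (auto simp: entire_def)
  obtain u :: "real \<times> (real ^ 'n) \<Rightarrow> real" where u: "weakly_harmonic_on UNIV u" "\<And>y. u (0, y) = \<Lambda> (F (complex_vec y))"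
    using entire_data_harmonic_extension[OF F(1) \<Lambda> \<Lambda>_le] by blast
  have "weakly_harmonic_on UNIV (\<lambda>p. u (p + (-a, 0)))"
    using u(1) unfolding weakly_harmonic_on_def
    by (auto simp del: split_paired_All intro!: line_laplacian_translate continuous_on_compose2[of UNIV u] continuous_intros)
  with u(2) F(2) show ?thesis by (intro exI[of _ "\<lambda>p. u (p + (-a, 0))"]) simp
qed

theorem theorem1:
  fixes a b :: real
    and f0 f1 :: "real ^ 'n::finite \<Rightarrow> complex"
    and h :: "real \<times> (real ^ 'n) \<Rightarrow> complex"
  assumes "a < b"
    and "entire f0" and "entire f1"
    and "slab_dirichlet_solution a b f0 f1 h"
  shows "\<exists>h' :: real \<times> (real ^ 'n) \<Rightarrow> complex.
           harmonic_on UNIV h' \<and> (\<forall>p \<in> slab a b. h' p = h p)"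
proof -
  from assms(4) have cont: "continuous_on ({a..b} \<times> UNIV) h" and harm: "harmonic_on (slab a b) h"
    and bd: "\<And>y. h (a, y) = f0 y" "\<And>y. h (b, y) = f1 y"
    by (auto simp: slab_dirichlet_solution_def)
  have "\<exists>g. weakly_harmonic_on UNIV g \<and> (\<forall>p. fst p \<in> {a<..<b} \<longrightarrow> g p = \<Lambda> (h p))"
    if \<Lambda>: "bounded_linear \<Lambda>" "\<And>z. \<bar>\<Lambda> z\<bar> \<le> norm z" for \<Lambda> :: "complex \<Rightarrow> real"
  proof (rule slab_solution_extends_globally)
    have "line_laplacian (\<lambda>p. \<Lambda> (h p)) p 0" if "fst p \<in> {a<..<b}" for p
      by (rule harmonic_on_imp_line_laplacian[OF harm _ \<Lambda>(1)]) (use that in \<open>simp add: slab_def mem_Times_iff\<close>)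
    then show "slab_solution a b (\<lambda>p. \<Lambda> (h p))"
      unfolding slab_solution_def
      using entire_data_on_hyperplane[OF assms(2) \<Lambda>, of a] entire_data_on_hyperplane[OF assms(3) \<Lambda>, of b]
        bounded_linear.continuous_on[OF \<Lambda>(1) cont] assms(1)
      by (auto simp: bd simp del: split_paired_All)
  qed
  note extend = this
  obtain u where u: "weakly_harmonic_on UNIV u" "\<And>p. fst p \<in> {a<..<b} \<Longrightarrow> u p = Re (h p)"
    using extend[OF bounded_linear_Re abs_Re_le_cmod] by blast
  obtain v where v: "weakly_harmonic_on UNIV v" "\<And>p. fst p \<in> {a<..<b} \<Longrightarrow> v p = Im (h p)"
    using extend[OF bounded_linear_Im abs_Im_le_cmod] by blast
  have "harmonic_on UNIV (\<lambda>p. Complex (u p) (v p))"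
    by (rule weakly_harmonic_imp_harmonic_on[OF u(1) v(1)])
  moreover have "Complex (u p) (v p) = h p" if "p \<in> slab a b" for p
    using that u(2)[of p] v(2)[of p] by (simp add: slab_def mem_Times_iff)
  ultimately show ?thesis by blast
qed

end
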